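(* Let $F$ be a finite field with $|F|=q=2^e$, $e>1$. Let $u=\begin{pmatrix}1&0\\1&1\end{pmatrix}$ and $r=\begin{pmatrix}0&\lambda\\ \lambda^{-1}&0\end{pmatrix}$ with $\lambda\in F^*$, and let $N$ be the normalizer in $\mathrm{SL}(2,F)$ of the maximal torus containing $ru$. If $g\in\mathrm{SL}(2,F)\setminus N$, then $\lambda$ and the entries of $g$ can be calculated (by the formulas listed in the context) using rational expressions in the square roots of the field elements $\mathbb B_{21}(g_1gg_2)$, where $g_1,g_2\in\{1,u,r\}^3$ range over those pairs for which $[u,u^{g_1gg_2}]\ne1$. In particular, if $\mathrm{SL}(2,F)=\langle\mathcal S\rangle$, then $F$ is generated as a field by the set $$\big\{\mathbb B_{21}(g_1gg_2)\ \big|\ g\in\mathcal S\cup\mathcal S^2,\ g_1,g_2\in\{1,u,r\}^3,\ \text{for which } [u,u^{g_1gg_2}]\ne1\big\}.$$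
   Context: Notation: $x^y=y^{-1}xy$, $[x,y]=x^{-1}y^{-1}xy$. For a subset $X$ of a group, $X^n$ denotes the set of products of $n$ elements of $X$. "Generated as a field" means that the set lies in no proper subfield of $F$. Every element of $F$ has a unique square root in $F$. The partial function $\mathbb B$: write $q^2-1=2k+1$. For $g\in\mathrm{SL}(2,F)$ with $[u,u^g]\ne1$ put $\mathbb B(g):=(uu^g)^{k+1}g^{-1}$; otherwise $\mathbb B(g)$ is undefined. $\mathbb B_{21}(g)$ denotes the $(2,1)$-entry of the matrix $\mathbb B(g)$. The formulas. For $g=\begin{pmatrix}a&b\\c&d\end{pmatrix}\in\mathrm{SL}(2,F)$ define $A,B,C,D$, whenever the corresponding value of $\mathbb B$ is defined, by $\mathbb B_{21}(g)=1+A$, $\mathbb B_{21}(gr)=1+B$, $\mathbb B_{21}(rg)=1+C$, $\mathbb B_{21}(rgr)=1+D$. (1) If $A,B,C,D$ are all defined and nonzero, then $\lambda$ is determined by $ABCD\lambda^2=(A+D)(B+C)$, and $a=\frac{ACD}{\Delta}$, $b=\frac{D(B+C)}{\Delta}$, $c=\frac{\lambda^{-2}A(B+C)}{\Delta}$, $d=\frac{ABD}{\Delta}$, where $\Delta=\sqrt{\lambda^{-2}AD(B+C)(A+B+C+D)}\ne0$. (2) If $A$ is not defined but $B,C,D$ are defined and nonzero, then $\lambda$ is determined by $BCD\lambda^2=B+C$, and $a=\frac{C}{\Delta}$, $b=0$, $c=\frac{BC}{\Delta}$, $d=\frac{B}{\Delta}$, where $\Delta=\sqrt{BC}\ne0$.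 (3) In the remaining cases, the formulas (1) or (2) are applied to a suitable matrix $g'=g_1gg_2$ (with $g_1,g_2$ products of the elements $u,r$ such that $g',g'r,rg',rg'r$ all lie in $\{1,u,r\}^3\,g\,\{1,u,r\}^3$) in place of $g$. The entries of $g$ are then recovered from $\lambda$ and the entries of $g'$ by multiplying by the matrices $g_1^{-1}$ and $g_2^{-1}$. *)

theory Defs
  imports
    "HOL-Analysis.Determinants"
    "HOL-Algebra.Algebra"
    "HOL-Algebra.Algebraic_Closure_Type"
begin

definition commutator :: "('g, 'b) monoid_scheme \<Rightarrow> 'g \<Rightarrow> 'g \<Rightarrow> 'g" where
  "commutator G x y = inv\<^bsub>G\<^esub> x \<otimes>\<^bsub>G\<^esub> inv\<^bsub>G\<^esub> y \<otimes>\<^bsub>G\<^esub> x \<otimes>\<^bsub>G\<^esub> y"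

definition conjugate :: "('g, 'b) monoid_scheme \<Rightarrow> 'g \<Rightarrow> 'g \<Rightarrow> 'g" where
  "conjugate G x y = inv\<^bsub>G\<^esub> y \<otimes>\<^bsub>G\<^esub> x \<otimes>\<^bsub>G\<^esub> y"

primrec set_power :: "('g, 'b) monoid_scheme \<Rightarrow> 'g set \<Rightarrow> nat \<Rightarrow> 'g set" where
  "set_power G Y 0 = {\<one>\<^bsub>G\<^esub>}"
| "set_power G Y (Suc n) = set_power G Y n <#>\<^bsub>G\<^esub> Y"

definition SL2 :: "('a::field ^ 2 ^ 2) monoid" where
  "SL2 = \<lparr>carrier = {A. det A = 1}, monoid.mult = (**), one = mat 1\<rparr>"

definition mat2 :: "'a \<Rightarrow> 'a \<Rightarrow> 'a \<Rightarrow> 'a \<Rightarrow> 'a::zero ^ 2 ^ 2" where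
  "mat2 a b c d = vector [vector [a, b], vector [c, d]]"

text \<open>
  The maximal tori of the algebraic group \<open>SL\<^sub>2\<close> over the algebraic closure of the finite field
  \<open>F\<close> are the conjugates of the group of diagonal matrices. Such a torus is defined over \<open>F\<close> iff
  it is stable under the Frobenius map \<open>x \<mapsto> x\<^sup>q\<close> with \<open>q = |F|\<close>; a maximal torus of
  \<open>SL(2,F)\<close> is the group of its \<open>F\<close>-rational points.
\<close>
definition maximal_torus :: "('a::{field,finite} ^ 2 ^ 2) set \<Rightarrow> bool" where
  "maximal_torus T \<longleftrightarrow>
     (\<exists>P \<in> carrier (SL2 :: ('a alg_closure ^ 2 ^ 2) monoid).
       let T' = (\<lambda>D. P \<otimes>\<^bsub>SL2\<^esub> D \<otimes>\<^bsub>SL2\<^esub> inv\<^bsub>SL2\<^esub> P) ` {D \<in> carrier SL2. D $ 1 $ 2 = 0 \<and> D $ 2 $ 1 = 0}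
       in map_matrix (\<lambda>x. x ^ CARD('a)) ` T' = T' \<and>
          T = {g \<in> carrier SL2. map_matrix to_ac g \<in> T'})"

definition torus_containing :: "'a::{field,finite} ^ 2 ^ 2 \<Rightarrow> ('a ^ 2 ^ 2) set" where
  "torus_containing x = (THE T. maximal_torus T \<and> x \<in> T)"

text \<open>Only meaningful where every element has exactly one square root, as in a finite field of
  characteristic 2.\<close>
definition sqroot :: "'a::field \<Rightarrow> 'a" where
  "sqroot x = (THE y. y ^ 2 = x)"

definition u_elt :: "'a::field ^ 2 ^ 2" where
  "u_elt = mat2 1 0 1 1"

text \<open>This has determinant \<open>-1\<close>, hence lies in \<open>SL(2,F)\<close> only in characteristic 2.\<close>
definition r_elt :: "'a::field \<Rightarrow> 'a ^ 2 ^ 2" where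
  "r_elt lam = mat2 0 lam (inverse lam) 0"

text \<open>Here \<open>k\<close> is the solution of \<open>q\<^sup>2 - 1 = 2 * k + 1\<close> for even \<open>q\<close>; the value
  \<open>None\<close> stands for ``undefined''.\<close>
definition BB :: "'a::{field,finite} ^ 2 ^ 2 \<Rightarrow> ('a ^ 2 ^ 2) option" where
  "BB g =
     (let k = (CARD('a) ^ 2 - 2) div 2; v = conjugate SL2 u_elt g in
      if commutator SL2 u_elt v \<noteq> \<one>\<^bsub>SL2\<^esub>
      then Some ((u_elt \<otimes>\<^bsub>SL2\<^esub> v) [^]\<^bsub>SL2\<^esub> (k + 1) \<otimes>\<^bsub>SL2\<^esub> inv\<^bsub>SL2\<^esub> g)
      else None)"

definition BB21 :: "'a::{field,finite} ^ 2 ^ 2 \<Rightarrow> 'a option" where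
  "BB21 g = map_option (\<lambda>M. M $ 2 $ 1) (BB g)"

definition words3 :: "'a::field \<Rightarrow> ('a ^ 2 ^ 2) set" where
  "words3 lam = set_power SL2 {\<one>\<^bsub>SL2\<^esub>, u_elt, r_elt lam} 3"

text \<open>Undefined values of \<open>BB21\<close> are omitted.\<close>
definition BB21_values :: "'a::{field,finite} \<Rightarrow> ('a ^ 2 ^ 2) set \<Rightarrow> 'a set" where
  "BB21_values lam Y =
     {y. \<exists>g \<in> Y. \<exists>g1 \<in> words3 lam. \<exists>g2 \<in> words3 lam.
           BB21 (g1 \<otimes>\<^bsub>SL2\<^esub> g \<otimes>\<^bsub>SL2\<^esub> g2) = Some y}"

text \<open>The quantities \<open>A, B, C, D\<close>, given by \<open>BB21 g = 1 + A\<close> and so on.\<close>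
definition ABCD_values ::
  "'a::{field,finite} \<Rightarrow> 'a ^ 2 ^ 2 \<Rightarrow> 'a option \<times> 'a option \<times> 'a option \<times> 'a option" where
  "ABCD_values lam g =
     (let r = r_elt lam; f = (\<lambda>h. map_option (\<lambda>y. y - 1) (BB21 h)) in
      (f g, f (g \<otimes>\<^bsub>SL2\<^esub> r), f (r \<otimes>\<^bsub>SL2\<^esub> g), f (r \<otimes>\<^bsub>SL2\<^esub> g \<otimes>\<^bsub>SL2\<^esub> r)))"

definition case1 :: "'a::{field,finite} \<Rightarrow> 'a ^ 2 ^ 2 \<Rightarrow> 'a \<Rightarrow> 'a \<Rightarrow> 'a \<Rightarrow> 'a \<Rightarrow> bool" where
  "case1 lam g A B C D \<longleftrightarrow>
     ABCD_values lam g = (Some A, Some B, Some C, Some D) \<and> A \<noteq> 0 \<and> B \<noteq> 0 \<and> C \<noteq> 0 \<and> D \<noteq> 0"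

definition formulas1 :: "'a::field \<Rightarrow> 'a ^ 2 ^ 2 \<Rightarrow> 'a \<Rightarrow> 'a \<Rightarrow> 'a \<Rightarrow> 'a \<Rightarrow> bool" where
  "formulas1 lam g A B C D \<longleftrightarrow>
     (\<forall>x. A * B * C * D * x ^ 2 = (A + D) * (B + C) \<longleftrightarrow> x = lam) \<and>
     (let \<Delta> = sqroot (inverse (lam ^ 2) * A * D * (B + C) * (A + B + C + D)) in
       \<Delta> \<noteq> 0 \<and>
       g = mat2 (A * C * D / \<Delta>) (D * (B + C) / \<Delta>)
                (inverse (lam ^ 2) * A * (B + C) / \<Delta>) (A * B * D / \<Delta>))"

definition case2 :: "'a::{field,finite} \<Rightarrow> 'a ^ 2 ^ 2 \<Rightarrow> 'a \<Rightarrow> 'a \<Rightarrow> 'a \<Rightarrow> bool" where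
  "case2 lam g B C D \<longleftrightarrow>
     ABCD_values lam g = (None, Some B, Some C, Some D) \<and> B \<noteq> 0 \<and> C \<noteq> 0 \<and> D \<noteq> 0"

definition formulas2 :: "'a::field \<Rightarrow> 'a ^ 2 ^ 2 \<Rightarrow> 'a \<Rightarrow> 'a \<Rightarrow> 'a \<Rightarrow> bool" where
  "formulas2 lam g B C D \<longleftrightarrow>
     (\<forall>x. B * C * D * x ^ 2 = B + C \<longleftrightarrow> x = lam) \<and>
     (let \<Delta> = sqroot (B * C) in
       \<Delta> \<noteq> 0 \<and> g = mat2 (C / \<Delta>) 0 (B * C / \<Delta>) (B / \<Delta>))"

text \<open>\<open>h\<close> is the matrix \<open>g'\<close> of case (3).\<close>
definition reduction3 :: "'a::{field,finite} \<Rightarrow> 'a ^ 2 ^ 2 \<Rightarrow> bool" where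
  "reduction3 lam g \<longleftrightarrow>
     (\<exists>g1 \<in> generate SL2 {u_elt, r_elt lam}. \<exists>g2 \<in> generate SL2 {u_elt, r_elt lam}.
       let r = r_elt lam; h = g1 \<otimes>\<^bsub>SL2\<^esub> g \<otimes>\<^bsub>SL2\<^esub> g2 in
       {h, h \<otimes>\<^bsub>SL2\<^esub> r, r \<otimes>\<^bsub>SL2\<^esub> h, r \<otimes>\<^bsub>SL2\<^esub> h \<otimes>\<^bsub>SL2\<^esub> r}
         \<subseteq> words3 lam <#>\<^bsub>SL2\<^esub> {g} <#>\<^bsub>SL2\<^esub> words3 lam \<and>
       ((\<exists>A B C D. case1 lam h A B C D \<and> formulas1 lam h A B C D) \<or>
        (\<exists>B C D. case2 lam h B C D \<and> formulas2 lam h B C D)) \<and>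
       g = inv\<^bsub>SL2\<^esub> g1 \<otimes>\<^bsub>SL2\<^esub> h \<otimes>\<^bsub>SL2\<^esub> inv\<^bsub>SL2\<^esub> g2)"

text \<open>\<open>generate_field\<close> is the set of values of all rational expressions in the given elements.\<close>
definition rational_in :: "'a::field set \<Rightarrow> 'a set" where
  "rational_in Y = generate_field ring_of_type_algebra Y"

definition generates_as_field :: "'a::field set \<Rightarrow> bool" where
  "generates_as_field Y \<longleftrightarrow>
     (\<forall>K. subfield K (ring_of_type_algebra :: 'a ring) \<and> Y \<subseteq> K \<longrightarrow> K = UNIV)"

end

(* In characteristic 2 write g = (a b; c d). The product w = u u^g has trace b^2, so by Cayley-Hamilton
   its square root (w + 1) / b has trace b; a power argument with Frobenius identifies this root with
   w^(k+1). Hence B_21(g) = 1 + (a + d) / b, defined exactly for b \<noteq> 0, and in terms of t = a + d and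
   v = b + lambda^2 c

     A = t / b,  B = v / (lambda^2 a),  C = v / (lambda^2 d),  D = t / (lambda^2 c),

   from which the formulas of cases (1) and (2) are direct computations. Up to multiplication by r on
   both sides, one of these cases applies as soon as t v \<noteq> 0 (two zero entries would force t v = 0).
   N consists of the elements that commute with or invert ru; outside N, one of
   g, u g u, u g, u g ru satisfies t v \<noteq> 0.

   For the second part choose s in S outside N; the entries of any g in S and N are recovered from
   those of s and g s, so SL(2,F) is contained in SL(2,K). *)

theory Submission
  imports Defs "HOL-Number_Theory.Residues"
begin

no_notation fps_nth (infixl "$" 75)

section \<open>Two-by-two matrices and the group SL(2,F)\<close>

lemma mat2_nth [simp]:
  "mat2 a b c d $ 1 $ 1 = a" "mat2 a b c d $ 1 $ 2 = b"
  "mat2 a b c d $ 2 $ 1 = c" "mat2 a b c d $ 2 $ 2 = d"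
  by (simp_all add: mat2_def)

lemma matrix2_eq_iff:
  "A = B \<longleftrightarrow> A $ 1 $ 1 = B $ 1 $ 1 \<and> A $ 1 $ 2 = B $ 1 $ 2 \<and> A $ 2 $ 1 = B $ 2 $ 1 \<and> A $ 2 $ 2 = B $ 2 $ 2"
  for A B :: "'a ^ 2 ^ 2"
  by (auto simp: vec_eq_iff forall_2)

lemma mat2_eq_iff [simp]:
  "mat2 a b c d = mat2 a' b' c' d' \<longleftrightarrow> a = a' \<and> b = b' \<and> c = c' \<and> d = d'"
  by (auto simp: matrix2_eq_iff)

lemma mat2_cases:
  fixes A :: "'a::zero ^ 2 ^ 2"
  obtains a b c d where "A = mat2 a b c d"
  using matrix2_eq_iff[of A "mat2 (A $ 1 $ 1) (A $ 1 $ 2) (A $ 2 $ 1) (A $ 2 $ 2)"] by simp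

lemma mat2_mult [simp]:
  fixes a :: "'a::semiring_1"
  shows "mat2 a b c d ** mat2 a' b' c' d' =
    mat2 (a * a' + b * c') (a * b' + b * d') (c * a' + d * c') (c * b' + d * d')"
  by (simp add: matrix2_eq_iff matrix_matrix_mult_def sum_2)

lemma det_mat2 [simp]: "det (mat2 a b c d) = a * d - b * c"
  for a :: "'a::comm_ring_1"
  by (simp add: det_2)

lemma mat_1_eq_mat2: "mat 1 = (mat2 1 0 0 1 :: 'a::field ^ 2 ^ 2)"
  by (simp add: matrix2_eq_iff mat_def)

lemma SL2_carrier: "carrier SL2 = {A. det A = 1}"
  and SL2_mult [simp]: "A \<otimes>\<^bsub>SL2\<^esub> B = A ** B"
  and SL2_one: "\<one>\<^bsub>SL2\<^esub> = mat2 1 0 0 1"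
  by (simp_all add: SL2_def mat_1_eq_mat2)

lemma mat2_in_SL2 [simp]: "mat2 a b c d \<in> carrier SL2 \<longleftrightarrow> a * d - b * c = 1"
  by (simp add: SL2_carrier)

lemma SL2_cases [consumes 1]:
  assumes "g \<in> carrier SL2"
  obtains a b c d where "g = mat2 a b c d" "a * d - b * c = 1"
  using assms by (cases g rule: mat2_cases) auto

lemma group_SL2: "group (SL2 :: ('a::field ^ 2 ^ 2) monoid)"
proof (rule groupI)
  fix x :: "'a ^ 2 ^ 2" assume "x \<in> carrier SL2"
  then obtain a b c d where x: "x = mat2 a b c d" "a * d - b * c = 1" by (rule SL2_cases)
  then show "\<exists>y\<in>carrier SL2. y \<otimes>\<^bsub>SL2\<^esub> x = \<one>\<^bsub>SL2\<^esub>"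
    by (intro bexI[of _ "mat2 d (- b) (- c) a"]) (auto simp: SL2_one algebra_simps)
qed (auto simp: SL2_carrier det_mul matrix_mul_assoc SL2_one mat_1_eq_mat2[symmetric])

interpretation SL2: group "SL2 :: ('a::field ^ 2 ^ 2) monoid"
  by (rule group_SL2)

lemma inv_SL2 [simp]:
  assumes "a * d - b * c = 1"
  shows "inv\<^bsub>SL2\<^esub> (mat2 a b c d) = mat2 d (- b) (- c) a"
  by (rule SL2.inv_equality) (use assms in \<open>auto simp: SL2_one algebra_simps\<close>)

subsection \<open>Characteristic 2\<close>

text \<open>Multiplication by a nonzero \<open>x\<close> permutes the nonzero elements, so their
  product is unchanged when it is scaled by \<open>x ^ (q - 1)\<close>, where q = |F|.\<close>

lemma power_CARD_eq_same:
  fixes x :: "'a::{field,finite}"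
  shows "x ^ CARD('a) = x"
proof (cases "x = 0")
  case False
  have "bij_betw ((*) x) (UNIV - {0}) (UNIV - {0})"
    using False by (intro bij_betwI[where g = "\<lambda>y. y / x"]) auto
  then have "(\<Prod>y\<in>UNIV - {0}. x * y) = \<Prod>(UNIV - {0})"
    by (rule prod.reindex_bij_betw)
  then have "x ^ (CARD('a) - 1) * \<Prod>(UNIV - {0}) = \<Prod>(UNIV - {0} :: 'a set)"
    by (simp add: prod.distrib card_Diff_subset)
  then have "x ^ (CARD('a) - 1) = 1" by simp
  then show ?thesis
    using power_minus_mult[of "CARD('a)" x] by simp
qed simp

lemma char2_of_card:
  assumes "CARD('a::{field,finite}) = 2 ^ e"
  shows "(2 :: 'a) = 0"
proof -
  have "of_nat (CARD('a)) = (0 :: 'a)"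
    using CHAR_dvd_CARD[where 'a = 'a] by (simp add: of_nat_eq_0_iff_char_dvd)
  then show ?thesis using assms by simp
qed

text \<open>As rewrite rules these remove all signs and cancel equal summands, so that the matrix
  identities below reduce to normalizing polynomials.\<close>

lemma char2_simps:
  assumes "(2 :: 'a::field) = 0"
  shows "- x = (x :: 'a)" "x - y = x + (y :: 'a)" "x + x = (0 :: 'a)" "x + (x + y) = (y :: 'a)"
    "2 * x = (0 :: 'a)" "x * 2 = (0 :: 'a)" "x + y = 0 \<longleftrightarrow> x = (y :: 'a)"
proof -
  have double: "x + x = 0" for x :: 'a
    using assms by (metis mult_2 mult_zero_left)
  show uminus: "- x = x" for x :: 'a
    using double[of x] by (simp add: minus_unique)
  show "x - y = x + y" by (simp add: uminus diff_conv_add_uminus del: add_uminus_conv_diff)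
  show "x + y = 0 \<longleftrightarrow> x = y" using uminus by (metis add_eq_0_iff)
  show "x + x = 0" by (rule double)
  show "x + (x + y) = y" using double by (simp flip: add.assoc)
qed (simp_all add: assms)

lemma char2_power_sum:
  assumes "(2 :: 'a::field) = 0"
  shows "(x + y) ^ (2 ^ n) = x ^ (2 ^ n) + (y :: 'a) ^ (2 ^ n)"
proof (induction n)
  case (Suc n)
  have "(x + y) ^ (2 ^ Suc n) = ((x + y) ^ (2 ^ n)) ^ 2"
    by (simp add: power_mult mult.commute flip: power_mult)
  also have "\<dots> = (x ^ (2 ^ n)) ^ 2 + (y ^ (2 ^ n)) ^ 2"
    unfolding Suc.IH by (simp add: power2_sum assms)
  finally show ?case by (simp add: mult.commute flip: power_mult)
qed simp

text \<open>By Cayley--Hamilton \<open>s\<^sup>2 = b s + 1\<close>, so all powers of \<open>s\<close> lie in the span of \<open>1\<close> and \<open>s\<close>; the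
  coefficient \<open>y\<close> depends on the trace \<open>b\<close> only.\<close>
lemma SL2_char2_pow_2_pow:
  fixes b :: "'a::field"
  assumes ch: "(2 :: 'a) = 0"
  shows "\<exists>y. \<forall>p q r s. p + s = b \<and> p * s - q * r = 1 \<longrightarrow>
    mat2 p q r s [^]\<^bsub>SL2\<^esub> (2 ^ n :: nat) =
    mat2 (b ^ (2 ^ n - 1) * p + y) (b ^ (2 ^ n - 1) * q) (b ^ (2 ^ n - 1) * r) (b ^ (2 ^ n - 1) * s + y)"
proof (induction n)
  case 0
  then show ?case by (intro exI[of _ 0]) (auto simp: SL2_one)
next
  case (Suc n)
  then obtain y where y: "\<And>p q r s. p + s = b \<Longrightarrow> p * s - q * r = 1 \<Longrightarrow>
    mat2 p q r s [^]\<^bsub>SL2\<^esub> (2 ^ n :: nat) =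
    mat2 (b ^ (2 ^ n - 1) * p + y) (b ^ (2 ^ n - 1) * q) (b ^ (2 ^ n - 1) * r) (b ^ (2 ^ n - 1) * s + y)"
    by blast
  define x where "x = b ^ (2 ^ n - 1)"
  have "2 ^ Suc n - 1 = Suc (2 * (2 ^ n - 1) :: nat)" by (cases "2 ^ n :: nat") simp_all
  then have x': "b ^ (2 ^ Suc n - 1) = x ^ 2 * b"
    by (simp add: x_def power_mult mult.commute power2_eq_square power_mult_distrib)
  show ?case
  proof (intro exI allI impI)
    fix p q r s assume *: "p + s = b \<and> p * s - q * r = 1"
    have "mat2 p q r s [^]\<^bsub>SL2\<^esub> (2 ^ Suc n :: nat) =
       (mat2 p q r s [^]\<^bsub>SL2\<^esub> (2 ^ n :: nat)) ** (mat2 p q r s [^]\<^bsub>SL2\<^esub> (2 ^ n :: nat))"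
      using * by (simp add: mult_2 SL2.nat_pow_mult flip: SL2_mult)
    also have "mat2 p q r s [^]\<^bsub>SL2\<^esub> (2 ^ n :: nat) = mat2 (x * p + y) (x * q) (x * r) (x * s + y)"
      unfolding x_def using y * by blast
    \<comment> \<open>For the given matrix M, the square of x M + y is x^2 M^2 + y^2, and M^2 = b M
      + 1 turns this into x^2 b M + (x^2 + y^2). The new scalar again does not involve the entries
      of M.\<close>
    also have "\<dots> ** \<dots> = mat2 (x\<^sup>2 * b * p + (x\<^sup>2 + y\<^sup>2)) (x\<^sup>2 * b * q) (x\<^sup>2 * b * r) (x\<^sup>2 * b * s + (x\<^sup>2 + y\<^sup>2))"
    proof -
      \<comment> \<open>The trace eliminates \<open>s\<close> and the determinant eliminates
        \<open>q * r\<close>, leaving a polynomial identity. \<open>qr'\<close> is the same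
        elimination for right-nested products.\<close>
      have s: "s = b + p"
        using * by (auto simp: char2_simps[OF ch] algebra_simps)
      have "p * s = 1 + q * r" using * by (simp only: diff_eq_eq)
      then have qr: "q * r = 1 + p * (b + p)"
        unfolding s by (simp only: char2_simps[OF ch])
      have qr': "q * (r * z) = z + p * (b + p) * z" for z
        unfolding mult.assoc[symmetric] qr by (simp add: algebra_simps)
      show ?thesis
        unfolding s by (simp add: char2_simps[OF ch] algebra_simps power2_eq_square qr qr')
    qed
    finally show "mat2 p q r s [^]\<^bsub>SL2\<^esub> (2 ^ Suc n :: nat) =
      mat2 (b ^ (2 ^ Suc n - 1) * p + (x\<^sup>2 + y\<^sup>2)) (b ^ (2 ^ Suc n - 1) * q) (b ^ (2 ^ Suc n - 1) * r)
       (b ^ (2 ^ Suc n - 1) * s + (x\<^sup>2 + y\<^sup>2))"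
      unfolding x' .
  qed
qed

text \<open>For nonzero trace b the coefficient b^(q-1) is 1, so M^q = M + y with y depending only
  on b. In characteristic 2 the matrix M + y has trace b as well, so the next q-th power adds the
  same y, and y + y = 0.\<close>

lemma SL2_pow_card_square:
  fixes p q r s :: "'a::{field,finite}"
  assumes card: "CARD('a) = 2 ^ e" and det: "p * s - q * r = 1" and tr: "p + s \<noteq> 0"
  shows "mat2 p q r s [^]\<^bsub>SL2\<^esub> (CARD('a) ^ 2) = mat2 p q r s"
proof -
  note ch = char2_of_card[OF card]
  define b where "b = p + s"
  obtain y where y: "\<And>p q r s. p + s = b \<Longrightarrow> p * s - q * r = 1 \<Longrightarrow>
    mat2 p q r s [^]\<^bsub>SL2\<^esub> (2 ^ e :: nat) =
    mat2 (b ^ (2 ^ e - 1) * p + y) (b ^ (2 ^ e - 1) * q) (b ^ (2 ^ e - 1) * r) (b ^ (2 ^ e - 1) * s + y)"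
    using SL2_char2_pow_2_pow[OF ch, of b e] by blast
  have "b ^ (2 ^ e - 1) * b = b ^ (2 ^ e)"
    by (metis power_minus_mult zero_less_numeral zero_less_power)
  also have "\<dots> = b" using power_CARD_eq_same[of b] card by simp
  finally have x: "b ^ (2 ^ e - 1) = 1" using tr b_def by simp
  have 1: "mat2 p q r s [^]\<^bsub>SL2\<^esub> (2 ^ e :: nat) = mat2 (p + y) q r (s + y)"
    using y[of p s q r] det x b_def by simp
  have in_SL2: "mat2 p q r s \<in> carrier SL2" using det by simp
  from SL2.nat_pow_closed[OF this, of "2 ^ e"] have det': "(p + y) * (s + y) - q * r = 1"
    unfolding 1 by simp
  have tr': "p + y + (s + y) = b" by (simp add: b_def char2_simps[OF ch] algebra_simps)
  have "mat2 p q r s [^]\<^bsub>SL2\<^esub> (CARD('a) ^ 2) =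
      (mat2 p q r s [^]\<^bsub>SL2\<^esub> (2 ^ e :: nat)) [^]\<^bsub>SL2\<^esub> (2 ^ e :: nat)"
    using in_SL2 by (simp add: SL2.nat_pow_pow card power2_eq_square)
  also have "\<dots> = mat2 (p + y + y) q r (s + y + y)"
    unfolding 1 using y[OF tr' det'] x by simp
  also have "\<dots> = mat2 p q r s" by (simp add: char2_simps[OF ch] add.assoc)
  finally show ?thesis .
qed

lemma char2_power2_inject:
  assumes "(2 :: 'a::field) = 0"
  shows "x\<^sup>2 = y\<^sup>2 \<longleftrightarrow> x = (y :: 'a)"
proof
  assume "x\<^sup>2 = y\<^sup>2"
  then have "(x + y)\<^sup>2 = 0" by (simp add: power2_sum char2_simps[OF assms] assms)
  then show "x = y" by (simp add: char2_simps[OF assms])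
qed simp

lemma sqroot_power2:
  assumes "(2 :: 'a::field) = 0"
  shows "sqroot (x\<^sup>2) = (x :: 'a)"
  unfolding sqroot_def by (rule the_equality) (simp_all add: char2_power2_inject[OF assms])

lemma (in group) commutator_eq_one_iff:
  assumes "x \<in> carrier G" "y \<in> carrier G"
  shows "commutator G x y = \<one> \<longleftrightarrow> x \<otimes> y = y \<otimes> x"
proof -
  have "commutator G x y = inv (y \<otimes> x) \<otimes> (x \<otimes> y)"
    using assms by (simp add: commutator_def inv_mult_group m_assoc)
  then show ?thesis
    using assms by (metis inv_closed inv_equality inv_inv l_inv m_closed)
qed

subsection \<open>Elements commuting with or inverting a given element\<close>

text \<open>Commuting is the case \<open>y = x\<close> and inverting the case
  \<open>y = inv x\<close>; this form treats both at once.\<close>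

lemma (in group) twisted_commute_inv:
  assumes "g \<in> carrier G" "x \<in> carrier G" "y \<in> carrier G" "g \<otimes> x = y \<otimes> g"
  shows "g \<otimes> inv x = inv y \<otimes> g" and "inv g \<otimes> y = x \<otimes> inv g"
proof -
  have "x = inv g \<otimes> (g \<otimes> x)"
    using assms(1,2) by (simp flip: m_assoc)
  then show "inv g \<otimes> y = x \<otimes> inv g"
    using assms by (simp add: inv_solve_right m_assoc)
  have "y \<otimes> (g \<otimes> inv x) = g"
  proof -
    have "y \<otimes> (g \<otimes> inv x) = g \<otimes> x \<otimes> inv x" using assms by (simp add: m_assoc)
    also have "\<dots> = g" using assms(1,2) by (simp add: m_assoc)
    finally show ?thesis .
  qed
  then show "g \<otimes> inv x = inv y \<otimes> g"
    using assms by (simp add: inv_solve_left)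
qed

text \<open>For x = ru this set stands in for N: an element outside N lies outside it, and its
  defining equations can be checked entry by entry.\<close>

definition commutes_or_inverts :: "('g, 'b) monoid_scheme \<Rightarrow> 'g \<Rightarrow> 'g set" where
  "commutes_or_inverts G x =
    {g \<in> carrier G. \<exists>y \<in> {x, inv\<^bsub>G\<^esub> x}. g \<otimes>\<^bsub>G\<^esub> x = y \<otimes>\<^bsub>G\<^esub> g}"

text \<open>Conjugation by such an element maps the pair x, x^-1 to itself, and maps of this kind
  compose and invert.\<close>

lemma (in group) subgroup_commutes_or_inverts:
  assumes x: "x \<in> carrier G"
  shows "subgroup (commutes_or_inverts G x) G"
proof (rule subgroupI)
  show "commutes_or_inverts G x \<noteq> {}"
    using x by (auto simp: commutes_or_inverts_def intro!: exI[of _ "\<one>"])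
next
  fix g assume "g \<in> commutes_or_inverts G x"
  then obtain y where g: "g \<in> carrier G" and y: "y \<in> {x, inv x}" "g \<otimes> x = y \<otimes> g"
    by (auto simp: commutes_or_inverts_def)
  have "y \<in> carrier G" using x y by auto
  note inv_g = twisted_commute_inv[OF g x this y(2)]
  show "inv g \<in> commutes_or_inverts G x"
  proof (cases "y = x")
    case True
    then show ?thesis using inv_g g by (auto simp: commutes_or_inverts_def)
  next
    case False
    then have "inv g \<otimes> inv x = x \<otimes> inv g" using inv_g y by auto
    then have "inv g \<otimes> inv (inv x) = inv x \<otimes> inv g"
      using g x by (intro twisted_commute_inv(1)) auto
    then show ?thesis using g x by (auto simp: commutes_or_inverts_def)
  qed
next
  fix g h assume "g \<in> commutes_or_inverts G x" "h \<in> commutes_or_inverts G x"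
  then obtain y z where g: "g \<in> carrier G" "y \<in> {x, inv x}" "g \<otimes> x = y \<otimes> g"
    and h: "h \<in> carrier G" "z \<in> {x, inv x}" "h \<otimes> x = z \<otimes> h"
    by (auto simp: commutes_or_inverts_def)
  obtain w where w: "w \<in> {x, inv x}" "g \<otimes> z = w \<otimes> g"
  proof (cases "z = x")
    case True
    then show ?thesis using that g by blast
  next
    case False
    then have "z = inv x" using h by auto
    then show ?thesis
      using twisted_commute_inv(1)[OF g(1) x _ g(3)] g(2) x by (auto intro!: that[of "inv y"])
  qed
  have carr: "z \<in> carrier G" "w \<in> carrier G" using h(2) w(1) x by auto
  then have "g \<otimes> h \<otimes> x = w \<otimes> (g \<otimes> h)"
    using g(1) h(1,3) w(2) x by (metis m_assoc)
  then show "g \<otimes> h \<in> commutes_or_inverts G x"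
    using w(1) g(1) h(1) by (auto simp: commutes_or_inverts_def)
qed (auto simp: commutes_or_inverts_def)

text \<open>Conjugation by \<open>g\<close> carries the centralizer of \<open>x\<close> to that of
  \<open>y\<close>, and \<open>x\<close> and \<open>inv x\<close> have the same centralizer.\<close>

lemma (in group) commutes_or_inverts_le_normalizer:
  assumes x: "x \<in> carrier G"
  shows "commutes_or_inverts G x \<subseteq> normalizer G {h \<in> carrier G. h \<otimes> x = x \<otimes> h}" (is "?N \<subseteq> normalizer G ?C")
proof
  have conj_in: "g \<otimes> h \<otimes> inv g \<in> ?C" if "g \<in> ?N" "h \<in> ?C" for g h
  proof -
    obtain y where g: "g \<in> carrier G" and y: "y \<in> {x, inv x}" "g \<otimes> x = y \<otimes> g"
      using \<open>g \<in> ?N\<close> by (auto simp: commutes_or_inverts_def)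
    have h: "h \<in> carrier G" "h \<otimes> x = x \<otimes> h" using that by auto
    have y_in: "y \<in> carrier G" using x y by auto
    have hx: "h \<otimes> (x \<otimes> inv g) = x \<otimes> (h \<otimes> inv g)"
      using g h x by (simp flip: m_assoc)
    have "g \<otimes> h \<otimes> inv g \<otimes> y = g \<otimes> (h \<otimes> x) \<otimes> inv g"
      using twisted_commute_inv(2)[OF g x y_in y(2)] g h x y_in by (simp add: m_assoc hx)
    also have "\<dots> = (g \<otimes> x) \<otimes> (h \<otimes> inv g)"
      using g h x by (simp add: m_assoc)
    also have "\<dots> = y \<otimes> (g \<otimes> h \<otimes> inv g)"
      using y(2) g h y_in by (simp add: m_assoc)
    finally have comm: "g \<otimes> h \<otimes> inv g \<otimes> y = y \<otimes> (g \<otimes> h \<otimes> inv g)" .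
    have k: "g \<otimes> h \<otimes> inv g \<in> carrier G" using g h by simp
    show ?thesis
      using y(1) comm twisted_commute_inv(1)[OF k y_in y_in comm] k x by auto
  qed
  fix g assume g: "g \<in> ?N"
  then have g_in: "g \<in> carrier G" by (simp add: commutes_or_inverts_def)
  have inv_g: "inv g \<in> ?N"
    using g subgroup.m_inv_closed[OF subgroup_commutes_or_inverts[OF x]] by blast
  have "g <# ?C #> inv g = (\<lambda>h. g \<otimes> h \<otimes> inv g) ` ?C"
    by (auto simp: l_coset_def r_coset_def)
  also have "\<dots> = ?C"
  proof (intro equalityI subsetI)
    fix h assume h: "h \<in> ?C"
    have "g \<otimes> (inv g \<otimes> k) = k" if "k \<in> carrier G" for k
      using g_in that by (simp flip: m_assoc)
    \<comment> \<open>The preimage of \<open>h\<close> is its conjugate under \<open>inv g\<close>,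
      which lies in \<open>?C\<close> because \<open>inv g\<close> is in \<open>?N\<close>
      too.\<close>
    then have "h = g \<otimes> (inv g \<otimes> h \<otimes> inv (inv g)) \<otimes> inv g"
      using g_in h by (simp add: m_assoc)
    then show "h \<in> (\<lambda>h. g \<otimes> h \<otimes> inv g) ` ?C"
      using conj_in[OF inv_g h] by (rule image_eqI)
  qed (use conj_in[OF g] in blast)
  finally have "g <# ?C #> inv g = ?C" .
  \<comment> \<open>\<open>normalizer\<close> is a stabilizer for conjugation of subsets, a map
    restricted to subsets of the carrier; membership in that domain unfolds it.\<close>
  moreover have "?C \<in> {H. H \<subseteq> carrier G}" by blast
  ultimately show "g \<in> normalizer G ?C"
    unfolding normalizer_def stabilizer_def using g_in
    by (simp only: restrict_apply' mem_Collect_eq)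
qed

subsection \<open>Subfields\<close>

text \<open>Carries the closure properties from the ring record to the type class operations. Since
  \<open>inverse 0 = 0\<close>, inversion and division need no side condition.\<close>

lemma subfield_type_closed:
  fixes K :: "'a::field set"
  assumes K: "subfield K ring_of_type_algebra"
  shows "0 \<in> K" and "1 \<in> K" and "x \<in> K \<Longrightarrow> - x \<in> K"
    and "x \<in> K \<Longrightarrow> y \<in> K \<Longrightarrow> x + y \<in> K" and "x \<in> K \<Longrightarrow> y \<in> K \<Longrightarrow> x - y \<in> K"
    and "x \<in> K \<Longrightarrow> y \<in> K \<Longrightarrow> x * y \<in> K" and "x \<in> K \<Longrightarrow> inverse x \<in> K"
    and "x \<in> K \<Longrightarrow> y \<in> K \<Longrightarrow> x / y \<in> K" and "x \<in> K \<Longrightarrow> x ^ n \<in> K"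
proof -
  let ?R = "ring_of_type_algebra :: 'a ring"
  interpret R: field ?R by (rule field_from_type_algebra)
  have R: "carrier ?R = UNIV" "\<zero>\<^bsub>?R\<^esub> = 0" "\<one>\<^bsub>?R\<^esub> = 1" "x \<oplus>\<^bsub>?R\<^esub> y = x + y" "x \<otimes>\<^bsub>?R\<^esub> y = x * y" for x y
    by (simp_all add: ring_of_type_algebra_def)
  have uminus: "\<ominus>\<^bsub>?R\<^esub> x = - x" for x
    using R.minus_equality[of "- x" x] by (simp add: R)
  have inverse: "inv\<^bsub>?R\<^esub> x = inverse x" if "x \<noteq> 0" for x
    using R.comm_inv_char[of x "inverse x"] that by (simp add: R)
  note subring = subringE[OF subfieldE(1)[OF K], unfolded R uminus]
  show zero: "0 \<in> K" and one: "1 \<in> K" using subring by auto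
  show neg: "x \<in> K \<Longrightarrow> - x \<in> K" for x using subring by auto
  show add: "x \<in> K \<Longrightarrow> y \<in> K \<Longrightarrow> x + y \<in> K" for x y using subring by auto
  show "x \<in> K \<Longrightarrow> y \<in> K \<Longrightarrow> x - y \<in> K" using add[of x "- y"] neg by simp
  show mult: "x \<in> K \<Longrightarrow> y \<in> K \<Longrightarrow> x * y \<in> K" for x y using subring by auto
  show inv: "x \<in> K \<Longrightarrow> inverse x \<in> K" for x
    using R.subfield_m_inv(1)[OF K, of x] inverse[of x] zero by (cases "x = 0") (auto simp: R)
  show "x \<in> K \<Longrightarrow> y \<in> K \<Longrightarrow> x / y \<in> K" using mult[of x "inverse y"] inv by (simp add: divide_inverse)
  show "x \<in> K \<Longrightarrow> x ^ n \<in> K" using one mult by (induction n) auto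
qed

text \<open>This is SL(2,K) inside SL(2,F); it lets factors with entries in \<open>K\<close> be
  multiplied on and cancelled.\<close>

lemma subgroup_SL2_subfield:
  fixes K :: "'a::field set"
  assumes K: "subfield K ring_of_type_algebra"
  shows "subgroup {g \<in> carrier SL2. \<forall>i j. g $ i $ j \<in> K} SL2"
proof (rule SL2.subgroupI)
  show "{g \<in> carrier SL2. \<forall>i j. g $ i $ j \<in> K} \<noteq> {}"
    using subfield_type_closed(1,2)[OF K]
    by (auto simp: forall_2 intro!: exI[of _ "mat2 1 0 0 1 :: 'a ^ 2 ^ 2"])
next
  fix g assume g: "g \<in> {g \<in> carrier SL2. \<forall>i j. g $ i $ j \<in> K}"
  then obtain a b c d where "g = mat2 a b c d" "a * d - b * c = 1"
    using SL2_cases by blast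
  then show "inv\<^bsub>SL2\<^esub> g \<in> {g \<in> carrier SL2. \<forall>i j. g $ i $ j \<in> K}"
    using g subfield_type_closed(3)[OF K] by (simp add: forall_2 mult.commute)
next
  fix g h assume "g \<in> {g \<in> carrier SL2. \<forall>i j. g $ i $ j \<in> K}" "h \<in> {g \<in> carrier SL2. \<forall>i j. g $ i $ j \<in> K}"
  moreover from this have "g ** h \<in> carrier SL2" using SL2.m_closed[of g h] by simp
  ultimately show "g \<otimes>\<^bsub>SL2\<^esub> h \<in> {g \<in> carrier SL2. \<forall>i j. g $ i $ j \<in> K}"
    using subfield_type_closed(4,6)[OF K] by (simp add: matrix_matrix_mult_def sum_2)
qed auto

subsection \<open>Centralizers over the algebraic closure\<close>

lemma map_matrix_mat2 [simp]: "map_matrix f (mat2 a b c d) = mat2 (f a) (f b) (f c) (f d)"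
  by (simp add: matrix2_eq_iff)

text \<open>Additivity holds because q is a power of 2, injectivity follows as there are no
  nilpotents, and surjectivity is the existence of q-th roots.\<close>

lemma alg_closure_Frobenius:
  fixes x y :: "'a::{field,finite} alg_closure"
  assumes card: "CARD('a) = 2 ^ e"
  shows "(2 :: 'a alg_closure) = 0"
    and "(x + y) ^ CARD('a) = x ^ CARD('a) + y ^ CARD('a)"
    and "x ^ CARD('a) = y ^ CARD('a) \<longleftrightarrow> x = y"
    and "\<exists>z. z ^ CARD('a) = x"
proof -
  have "to_ac (2 :: 'a) = 0" using char2_of_card[OF card] by simp
  then show ch: "(2 :: 'a alg_closure) = 0" by simp
  show add: "(x + y) ^ CARD('a) = x ^ CARD('a) + y ^ CARD('a)" for x y :: "'a alg_closure"
    unfolding card by (rule char2_power_sum[OF ch])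
  have "x ^ CARD('a) = y ^ CARD('a) \<longleftrightarrow> (x + y) ^ CARD('a) = 0"
    by (simp add: add char2_simps[OF ch])
  then show "x ^ CARD('a) = y ^ CARD('a) \<longleftrightarrow> x = y"
    by (simp add: char2_simps[OF ch])
  show "\<exists>z. z ^ CARD('a) = x" by (rule nth_root_exists) simp
qed

lemma commute_diagonal_iff:
  fixes al be :: "'a::field"
  assumes "al \<noteq> be"
  shows "Z ** mat2 al 0 0 be = mat2 al 0 0 be ** Z \<longleftrightarrow> Z $ 1 $ 2 = 0 \<and> Z $ 2 $ 1 = 0"
  using assms by (cases Z rule: mat2_cases) (auto simp: mult.commute)

text \<open>Only diagonal matrices commute with a diagonal matrix having distinct entries, and
  conjugation by \<open>P\<close> transports this to \<open>M\<close>. It serves both to exhibit the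
  centralizer of ru as a torus and to identify any torus containing ru.\<close>

lemma SL2_centralizer_conjugate:
  fixes P M :: "'a::field ^ 2 ^ 2"
  assumes P: "P \<in> carrier SL2" and ne: "al \<noteq> be" and D: "al * be = 1"
    and M: "M = P \<otimes>\<^bsub>SL2\<^esub> mat2 al 0 0 be \<otimes>\<^bsub>SL2\<^esub> inv\<^bsub>SL2\<^esub> P"
  shows "(\<lambda>D. P \<otimes>\<^bsub>SL2\<^esub> D \<otimes>\<^bsub>SL2\<^esub> inv\<^bsub>SL2\<^esub> P) ` {D \<in> carrier SL2. D $ 1 $ 2 = 0 \<and> D $ 2 $ 1 = 0} =
    {h \<in> carrier SL2. h ** M = M ** h}" (is "?conj ` ?Diag = ?C")
proof -
  let ?D = "mat2 al 0 0 be"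
  have D_in: "?D \<in> carrier SL2" using D by simp
  have comm: "Z \<otimes>\<^bsub>SL2\<^esub> ?D = ?D \<otimes>\<^bsub>SL2\<^esub> Z \<longleftrightarrow> ?conj Z \<otimes>\<^bsub>SL2\<^esub> M = M \<otimes>\<^bsub>SL2\<^esub> ?conj Z"
    if Z: "Z \<in> carrier SL2" for Z
  proof -
    have conj_mult: "?conj A \<otimes>\<^bsub>SL2\<^esub> ?conj B = ?conj (A \<otimes>\<^bsub>SL2\<^esub> B)"
      if "A \<in> carrier SL2" "B \<in> carrier SL2" for A B
    proof -
      have "inv\<^bsub>SL2\<^esub> P \<otimes>\<^bsub>SL2\<^esub> (P \<otimes>\<^bsub>SL2\<^esub> Y) = Y" if "Y \<in> carrier SL2" for Y
        using that P by (simp del: SL2_mult flip: SL2.m_assoc)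
      then show ?thesis using that P by (simp add: SL2.m_assoc del: SL2_mult)
    qed
    have "Z \<otimes>\<^bsub>SL2\<^esub> ?D = ?D \<otimes>\<^bsub>SL2\<^esub> Z \<longleftrightarrow> ?conj (Z \<otimes>\<^bsub>SL2\<^esub> ?D) = ?conj (?D \<otimes>\<^bsub>SL2\<^esub> Z)"
      using Z D_in P by (simp del: SL2_mult)
    then show ?thesis
      unfolding M conj_mult[OF Z D_in] conj_mult[OF D_in Z] .
  qed
  show ?thesis
  proof (intro equalityI subsetI)
    fix h assume "h \<in> ?conj ` ?Diag"
    then obtain Z where Z: "Z \<in> ?Diag" and h: "h = ?conj Z" by blast
    then have "Z \<otimes>\<^bsub>SL2\<^esub> ?D = ?D \<otimes>\<^bsub>SL2\<^esub> Z"
      using commute_diagonal_iff[OF ne, of Z] by simp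
    then show "h \<in> ?C" using Z P comm[of Z] unfolding h SL2_mult[symmetric]
      by (simp del: SL2_mult)
  next
    fix h assume h: "h \<in> ?C"
    define Z where "Z = inv\<^bsub>SL2\<^esub> P \<otimes>\<^bsub>SL2\<^esub> h \<otimes>\<^bsub>SL2\<^esub> P"
    have Z_in: "Z \<in> carrier SL2" using h P by (simp add: Z_def del: SL2_mult)
    have hZ: "h = ?conj Z"
    proof -
      have "P \<otimes>\<^bsub>SL2\<^esub> (inv\<^bsub>SL2\<^esub> P \<otimes>\<^bsub>SL2\<^esub> Y) = Y" if "Y \<in> carrier SL2" for Y
        using that P by (simp del: SL2_mult flip: SL2.m_assoc)
      then show ?thesis using h P by (simp add: Z_def SL2.m_assoc del: SL2_mult)
    qed
    have "Z \<otimes>\<^bsub>SL2\<^esub> ?D = ?D \<otimes>\<^bsub>SL2\<^esub> Z" using comm[OF Z_in] h unfolding hZ[symmetric] by simp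
    then have "Z \<in> ?Diag" using commute_diagonal_iff[OF ne, of Z] Z_in by simp
    then show "h \<in> ?conj ` ?Diag" using hZ by blast
  qed
qed

text \<open>Records only that one of the two nonvanishing patterns occurs; that the formulas then
  hold is proved separately.\<close>

definition formulas_apply :: "'a::{field,finite} \<Rightarrow> 'a ^ 2 ^ 2 \<Rightarrow> bool" where
  "formulas_apply lam h \<longleftrightarrow> (\<exists>A B C D. case1 lam h A B C D) \<or> (\<exists>B C D. case2 lam h B C D)"

context
  fixes lam :: "'a::{field,finite}" and e :: nat
  assumes card: "CARD('a) = 2 ^ e" and e: "e > 0" and lam: "lam \<noteq> 0"
begin

abbreviation "ru \<equiv> r_elt lam ** u_elt"

lemmas char2 = char2_simps[OF char2_of_card[OF card]] char2_of_card[OF card]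

subsection \<open>The values of \<open>BB21\<close> and the formulas\<close>

lemma BB21_mat2:
  fixes a b c d :: "'a::{field,finite}"
  assumes det: "a * d - b * c = 1"
  shows "BB21 (mat2 a b c d) = (if b = 0 then None else Some (1 + (a + d) / b))"
proof -
  have det': "a * d = 1 + b * c" using det by (simp only: diff_eq_eq)
  let ?g = "mat2 a b c d" and ?u = "u_elt :: 'a ^ 2 ^ 2"
  let ?v = "mat2 (1 + a * b) (b\<^sup>2) (a\<^sup>2) (1 + a * b)"
  have u: "?u = mat2 1 0 1 1" by (simp add: u_elt_def)
  have inv_g: "inv\<^bsub>SL2\<^esub> ?g = mat2 d b c a"
    using det by (simp add: char2)
  have v: "conjugate SL2 ?u ?g = ?v"
    unfolding conjugate_def inv_g u using det'
    by (simp add: char2 algebra_simps power2_eq_square)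
  have v_in: "?v \<in> carrier SL2"
    by (simp add: char2 algebra_simps power2_eq_square)
  have u_in: "?u \<in> carrier SL2" by (simp add: u)
  have comm: "commutator SL2 ?u ?v = \<one>\<^bsub>SL2\<^esub> \<longleftrightarrow> b = 0"
  proof -
    have "commutator SL2 ?u ?v = \<one>\<^bsub>SL2\<^esub> \<longleftrightarrow> ?u ** ?v = ?v ** ?u"
      using SL2.commutator_eq_one_iff[OF u_in v_in] by simp
    also have "\<dots> \<longleftrightarrow> b = 0"
      by (simp add: u char2 algebra_simps)
    finally show ?thesis .
  qed
  show ?thesis
  proof (cases "b = 0")
    case True
    then show ?thesis using comm v by (simp add: BB21_def BB_def)
  next
    case False
    \<comment> \<open>This is (w + 1) / b for w = \<open>?u ** ?v\<close>, written out: w has trace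
      b^2, so (w + 1)^2 = w^2 + 1 = b^2 w.\<close>
    define s where "s = mat2 a b ((1 + a\<^sup>2) / b + a) (a + b)"
    define k where "k = (CARD('a) ^ 2 - 2) div 2"
    have s_in: "s \<in> carrier SL2"
      unfolding s_def using False by (simp add: char2 field_simps power2_eq_square)
    have "s [^]\<^bsub>SL2\<^esub> (2 :: nat) = ?u ** ?v"
      unfolding numeral_2_eq_2 using False s_in
      by (simp add: SL2_one s_def u char2 field_simps power2_eq_square)
    then have "(?u ** ?v) [^]\<^bsub>SL2\<^esub> (k + 1) = s [^]\<^bsub>SL2\<^esub> (2 * (k + 1))"
      using s_in by (metis SL2.nat_pow_pow)
    \<comment> \<open>As q^2 is even and positive, the truncated subtraction and the division in
      \<open>k\<close> are exact.\<close>
    also have "2 * (k + 1) = CARD('a) ^ 2"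
    proof -
      have "even (CARD('a) ^ 2)" "CARD('a) ^ 2 > 0"
        using e by (auto simp: card)
      then show ?thesis unfolding k_def by (elim evenE) auto
    qed
    also have "s [^]\<^bsub>SL2\<^esub> (CARD('a) ^ 2) = s"
      unfolding s_def
      by (rule SL2_pow_card_square[OF card])
        (use s_in False in \<open>simp_all add: s_def char2\<close>)
    finally have "BB ?g = Some (s ** mat2 d b c a)"
      using False comm by (simp add: BB_def Let_def v inv_g k_def)
    moreover have "((1 + a\<^sup>2) / b + a) * d + (a + b) * c = 1 + (a + d) / b"
    proof -
      \<comment> \<open>The denominator is cleared first; replacing \<open>a * d\<close> by
        \<open>1 + b * c\<close> then leaves a + b + d after cancellation.\<close>
      have "b * (((1 + a\<^sup>2) / b + a) * d + (a + b) * c) = d + a * (a * d) + b * (a * d) + a * (b * c) + b * b * c"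
        using False by (simp add: field_simps power2_eq_square)
      also have "\<dots> = b * (1 + (a + d) / b)"
        using False by (simp add: det' char2 field_simps)
      finally show ?thesis using False by simp
    qed
    ultimately show ?thesis using False by (simp add: BB21_def s_def)
  qed
qed

text \<open>Multiplying by r on the right, on the left or on both sides brings a, d or c, up to a
  power of \<open>lam\<close>, to the upper right corner. So \<open>BB21_mat2\<close> applies with
  each entry in turn as denominator.\<close>

lemma ABCD_values_mat2:
  fixes a b c d :: "'a::{field,finite}"
  assumes det: "a * d - b * c = 1"
  shows "ABCD_values lam (mat2 a b c d) =
    ((if b = 0 then None else Some ((a + d) / b)),
     (if a = 0 then None else Some ((b + lam\<^sup>2 * c) / (lam\<^sup>2 * a))),
     (if d = 0 then None else Some ((b + lam\<^sup>2 * c) / (lam\<^sup>2 * d))),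
     (if c = 0 then None else Some ((a + d) / (lam\<^sup>2 * c))))"
proof -
  have det': "a * d = 1 + b * c" using det by (simp only: diff_eq_eq)
  let ?g = "mat2 a b c d"
  have r: "r_elt lam = mat2 0 lam (1 / lam) 0"
    by (simp add: r_elt_def field_simps)
  have "BB21 ?g = (if b = 0 then None else Some (1 + (a + d) / b))"
    by (rule BB21_mat2[OF det])
  moreover have gr: "?g ** r_elt lam = mat2 (b / lam) (a * lam) (d / lam) (c * lam)"
    by (simp add: r)
  moreover have "BB21 (mat2 (b / lam) (a * lam) (d / lam) (c * lam)) =
      (if a = 0 then None else Some (1 + (b + lam\<^sup>2 * c) / (lam\<^sup>2 * a)))"
    by (subst BB21_mat2)
      (use lam det' in \<open>auto simp: char2 field_simps power2_eq_square\<close>)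
  moreover have rg: "r_elt lam ** ?g = mat2 (lam * c) (lam * d) (a / lam) (b / lam)"
    by (simp add: r)
  moreover have "BB21 (mat2 (lam * c) (lam * d) (a / lam) (b / lam)) =
      (if d = 0 then None else Some (1 + (b + lam\<^sup>2 * c) / (lam\<^sup>2 * d)))"
    by (subst BB21_mat2)
      (use lam det' in \<open>auto simp: char2 field_simps power2_eq_square\<close>)
  moreover have rgr: "mat2 (lam * c) (lam * d) (a / lam) (b / lam) ** r_elt lam = mat2 d (lam\<^sup>2 * c) (b / lam\<^sup>2) a"
    using lam by (simp add: r field_simps power2_eq_square)
  moreover have "BB21 (mat2 d (lam\<^sup>2 * c) (b / lam\<^sup>2) a) =
      (if c = 0 then None else Some (1 + (a + d) / (lam\<^sup>2 * c)))"
    by (subst BB21_mat2)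
      (use lam det' in \<open>auto simp: char2 field_simps power2_eq_square\<close>)
  ultimately show ?thesis
    unfolding ABCD_values_def Let_def SL2_mult gr rg rgr by simp
qed

text \<open>The hypotheses force all entries as well as t and v to be nonzero. Both A + D and B + C
  then have numerator t v, so every expression in the formulas becomes a monomial in t, v,
  \<open>lam\<close> and the entries.\<close>

lemma case1_formulas1:
  fixes g :: "'a::{field,finite} ^ 2 ^ 2"
  assumes g: "g \<in> carrier SL2"
    and case1: "case1 lam g A B C D"
  shows "formulas1 lam g A B C D"
proof -
  obtain a b c d where g_eq: "g = mat2 a b c d" and det: "a * d - b * c = 1"
    using g by (rule SL2_cases)
  have det': "a * d + b * c = 1" using det by (simp add: char2)
  define t where "t = a + d"
  define v where "v = b + lam\<^sup>2 * c"
  have nz: "a \<noteq> 0" "b \<noteq> 0" "c \<noteq> 0" "d \<noteq> 0" "t \<noteq> 0" "v \<noteq> 0"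
    and ABCD: "A = t / b" "B = v / (lam\<^sup>2 * a)" "C = v / (lam\<^sup>2 * d)" "D = t / (lam\<^sup>2 * c)"
    using case1 unfolding case1_def g_eq ABCD_values_mat2[OF det] t_def v_def
    by (auto split: if_splits)
  have AD: "A + D = t * v / (lam\<^sup>2 * b * c)"
    using nz lam by (simp add: ABCD field_simps) (simp add: v_def algebra_simps)
  have BC: "B + C = t * v / (lam\<^sup>2 * a * d)"
    using nz lam by (simp add: ABCD field_simps) (simp add: t_def algebra_simps)
  \<comment> \<open>The two fractions combine to the numerator factor \<open>a * d + b * c\<close>,
    which is the determinant in characteristic 2.\<close>
  have sum: "A + B + C + D = t * v / (lam\<^sup>2 * a * b * c * d)"
  proof -
    have "A + B + C + D = t * v / lam\<^sup>2 * ((a * d + b * c) / (a * b * c * d))"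
    proof -
      have "A + B + C + D = (A + D) + (B + C)" by (simp add: add_ac)
      then show ?thesis unfolding AD BC using nz lam by (simp add: field_simps)
    qed
    then show ?thesis by (simp add: det' field_simps)
  qed
  have 1: "A * B * C * D * x\<^sup>2 = (A + D) * (B + C) \<longleftrightarrow> x = lam" for x
  proof -
    have "A * B * C * D * lam\<^sup>2 = (A + D) * (B + C)"
      unfolding AD BC using nz lam by (simp add: ABCD field_simps power2_eq_square)
    moreover have "A * B * C * D \<noteq> 0" using case1 by (simp add: case1_def)
    ultimately have "A * B * C * D * x\<^sup>2 = (A + D) * (B + C) \<longleftrightarrow> x\<^sup>2 = lam\<^sup>2"
      by (metis mult_left_cancel)
    then show ?thesis by (simp add: char2_power2_inject[OF char2(8)])
  qed
  \<comment> \<open>Substitution makes the radicand t^4 v^2 / (lam^8 (abcd)^2), whose square root is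
    visible.\<close>
  let ?Delta = "t\<^sup>2 * v / (lam ^ 4 * a * b * c * d)"
  have "inverse (lam\<^sup>2) * A * D * (B + C) * (A + B + C + D) = ?Delta\<^sup>2"
    unfolding BC sum using nz lam by (simp add: ABCD field_simps power2_eq_square power4_eq_xxxx)
  then have 2: "sqroot (inverse (lam\<^sup>2) * A * D * (B + C) * (A + B + C + D)) = ?Delta"
    using sqroot_power2[OF char2(8)] by simp
  have "a = A * C * D / ?Delta" "b = D * (B + C) / ?Delta"
    "c = inverse (lam\<^sup>2) * A * (B + C) / ?Delta" "d = A * B * D / ?Delta"
    unfolding BC using nz lam by (simp_all add: ABCD field_simps power2_eq_square power4_eq_xxxx)
  then show ?thesis
    unfolding formulas1_def 2 Let_def g_eq using 1 nz lam by simp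
qed

text \<open>With b = 0 the determinant gives ad = 1, hence BC = c^2 and the square root is c
  itself.\<close>

lemma case2_formulas2:
  fixes g :: "'a::{field,finite} ^ 2 ^ 2"
  assumes g: "g \<in> carrier SL2"
    and case2: "case2 lam g B C D"
  shows "formulas2 lam g B C D"
proof -
  obtain a b c d where g_eq: "g = mat2 a b c d" and det: "a * d - b * c = 1"
    using g by (rule SL2_cases)
  have nz: "a \<noteq> 0" "b = 0" "c \<noteq> 0" "d \<noteq> 0" "a + d \<noteq> 0"
    and BCD: "B = c / a" "C = c / d" "D = (a + d) / (lam\<^sup>2 * c)"
    using case2 lam unfolding case2_def g_eq ABCD_values_mat2[OF det]
    by (auto split: if_splits)
  have ad: "a * d = 1" using det nz by simp
  then have d: "d = 1 / a" using nz by (simp add: field_simps)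
  have 1: "B * C * D * x\<^sup>2 = B + C \<longleftrightarrow> x = lam" for x
  proof -
    have "B * C * D * lam\<^sup>2 = B + C"
      using nz lam by (simp add: BCD field_simps power2_eq_square)
    moreover have "B * C * D \<noteq> 0" using case2 by (simp add: case2_def)
    ultimately have "B * C * D * x\<^sup>2 = B + C \<longleftrightarrow> x\<^sup>2 = lam\<^sup>2"
      by (metis mult_left_cancel)
    then show ?thesis by (simp add: char2_power2_inject[OF char2(8)])
  qed
  have "B * C = c\<^sup>2" using nz ad by (simp add: BCD power2_eq_square)
  then have 2: "sqroot (B * C) = c"
    using sqroot_power2[OF char2(8)] by simp
  have "a = C / c" "c = B * C / c" "d = B / c"
    using nz by (simp_all add: BCD d field_simps)
  then show ?thesis
    unfolding formulas2_def 2 Let_def g_eq using 1 nz lam by simp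
qed

lemma ru_eq: "ru = mat2 lam lam (1 / lam) 0"
  by (simp add: r_elt_def u_elt_def divide_inverse)

lemma inv_ru_eq: "inv\<^bsub>SL2\<^esub> (mat2 lam lam (1 / lam) 0) = mat2 0 lam (1 / lam) lam"
  using lam by (simp add: char2)

subsection \<open>The torus containing \<open>ru\<close>\<close>

text \<open>The entries of ru lie in F and are fixed by the Frobenius map, which is bijective and
  respects products and determinants. So it permutes the matrices of determinant 1 commuting with
  ru.\<close>

lemma centralizer_Frobenius_stable:
  "map_matrix (\<lambda>x. x ^ CARD('a)) ` {h \<in> carrier SL2. h ** map_matrix to_ac ru = map_matrix to_ac ru ** h} =
   {h \<in> carrier SL2. h ** map_matrix to_ac ru = map_matrix to_ac ru ** h}" (is "?Phi ` ?C = ?C")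
proof -
  note ch = char2_simps[OF alg_closure_Frobenius(1)[OF card]]
  let ?M = "map_matrix to_ac ru"
  note Frob = alg_closure_Frobenius(2,3)[OF card]
  have M: "?Phi ?M = ?M"
    using power_CARD_eq_same[of lam] by (simp add: ru_eq power_divide flip: to_ac_power)
  have Phi_mult: "?Phi (A ** B) = ?Phi A ** ?Phi B" for A B :: "'a alg_closure ^ 2 ^ 2"
    by (cases A rule: mat2_cases; cases B rule: mat2_cases) (simp add: Frob power_mult_distrib)
  have Phi_inj: "?Phi A = ?Phi B \<longleftrightarrow> A = B" for A B :: "'a alg_closure ^ 2 ^ 2"
    by (simp add: matrix2_eq_iff Frob)
  have det_Phi: "det (?Phi A) = det A ^ CARD('a)" for A :: "'a alg_closure ^ 2 ^ 2"
    by (cases A rule: mat2_cases) (simp add: ch Frob power_mult_distrib)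
  have C_iff: "?Phi A \<in> ?C \<longleftrightarrow> A \<in> ?C" for A
  proof -
    have "?Phi A ** ?M = ?M ** ?Phi A \<longleftrightarrow> A ** ?M = ?M ** A"
      using Phi_inj[of "A ** ?M" "?M ** A"] by (simp only: Phi_mult M)
    moreover have "det (?Phi A) = 1 \<longleftrightarrow> det A = 1"
      using Frob(2)[of "det A" 1] by (simp add: det_Phi)
    ultimately show ?thesis by (simp add: SL2_carrier)
  qed
  have "\<exists>B. ?Phi B = A" for A :: "'a alg_closure ^ 2 ^ 2"
  proof -
    obtain f where f: "\<And>x :: 'a alg_closure. f x ^ CARD('a) = x"
      using alg_closure_Frobenius(4)[OF card] by metis
    show ?thesis by (rule exI[of _ "map_matrix f A"]) (simp add: matrix2_eq_iff f)
  qed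
  then show ?thesis using C_iff by (metis (no_types, lifting) image_iff set_eq_iff)
qed

text \<open>As \<open>ru\<close> has trace \<open>lam \<noteq> 0\<close>, its eigenvalues in characteristic 2 are distinct, so a
  torus containing it is its centralizer.\<close>
lemma torus_containing_ru:
  "torus_containing ru = {g \<in> carrier SL2. g ** ru = ru ** g}"
proof -
  note ch2 = alg_closure_Frobenius(1)[OF card]
  note ch = char2_simps[OF ch2] ch2
  let ?M = "map_matrix to_ac ru" and ?l = "to_ac lam"
  have M_eq: "?M = mat2 ?l ?l (1 / ?l) 0" by (simp add: ru_eq)
  have l: "?l \<noteq> 0" using lam by simp
  have C_eq: "{g \<in> carrier SL2. map_matrix to_ac g \<in> {h \<in> carrier SL2. h ** ?M = ?M ** h}} =
    {g \<in> carrier SL2. g ** ru = ru ** g}"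
  proof -
    have mult: "map_matrix to_ac (A ** B) = map_matrix to_ac A ** map_matrix to_ac B" for A B :: "'a ^ 2 ^ 2"
      by (cases A rule: mat2_cases; cases B rule: mat2_cases) simp
    have inj: "map_matrix to_ac A = map_matrix to_ac B \<longleftrightarrow> A = B" for A B :: "'a ^ 2 ^ 2"
      by (simp add: matrix2_eq_iff)
    have det: "det (map_matrix to_ac A) = to_ac (det A)" for A :: "'a ^ 2 ^ 2"
      by (cases A rule: mat2_cases) simp
    show ?thesis
      by (auto simp: SL2_carrier det inj simp flip: mult)
  qed
  have trace_conj: "M $ 1 $ 1 + M $ 2 $ 2 = al + be"
    if P: "P \<in> carrier SL2" and M: "M = P \<otimes>\<^bsub>SL2\<^esub> mat2 al 0 0 be \<otimes>\<^bsub>SL2\<^esub> inv\<^bsub>SL2\<^esub> P"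
    for M P :: "'a alg_closure ^ 2 ^ 2" and al be
  proof -
    obtain p q r s where P: "P = mat2 p q r s" "p * s - q * r = 1"
      using P by (rule SL2_cases)
    then have "M $ 1 $ 1 + M $ 2 $ 2 = (p * s - q * r) * (al + be)"
      by (simp add: M algebra_simps)
    then show ?thesis using P by simp
  qed
  show ?thesis
    unfolding torus_containing_def
  proof (rule the_equality)
    show "maximal_torus {g \<in> carrier SL2. g ** ru = ru ** g} \<and> ru \<in> {g \<in> carrier SL2. g ** ru = ru ** g}"
    proof
      \<comment> \<open>\<open>al\<close> is a root of the characteristic polynomial X^2 + lam X + 1
        of ru; the other root is \<open>al + ?l\<close>.\<close>
      have "\<exists>al. (\<Sum>k\<le>2. [1, ?l, 1] ! k * al ^ k) = 0"
        by (rule alg_closed) simp_all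
      then obtain al where al: "1 + ?l * al + al\<^sup>2 = 0"
        by (auto simp: numeral_2_eq_2)
      define be where "be = al + ?l"
      \<comment> \<open>The columns are eigenvectors of ru for \<open>al\<close> and
        \<open>be\<close>. Since \<open>al + be = ?l\<close>, the lower entries
        \<open>1 / ?l\<close> make the determinant 1.\<close>
      define P where "P = mat2 al be (1 / ?l) (1 / ?l)"
      have al': "al * (al + ?l) = 1"
        using al by (simp add: ch algebra_simps power2_eq_square)
      have al2: "al * al = 1 + ?l * al"
        using al' by (simp add: ch algebra_simps flip: eq_diff_eq)
      have "al * be = 1" using al' by (simp add: be_def)
      moreover have "al \<noteq> be" using l by (simp add: be_def)
      moreover have P: "P \<in> carrier SL2"
        using l by (simp add: P_def be_def ch field_simps)
      moreover have M: "?M = P \<otimes>\<^bsub>SL2\<^esub> mat2 al 0 0 be \<otimes>\<^bsub>SL2\<^esub> inv\<^bsub>SL2\<^esub> P"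
      proof -
        have "?M \<in> carrier SL2" "mat2 al 0 0 be \<in> carrier SL2"
          using l al' by (simp_all add: M_eq ch be_def)
        moreover have "?M \<otimes>\<^bsub>SL2\<^esub> P = P \<otimes>\<^bsub>SL2\<^esub> mat2 al 0 0 be"
          using l al2 by (simp add: M_eq P_def be_def ch field_simps)
        ultimately show ?thesis using P by (simp add: SL2.inv_solve_right del: SL2_mult)
      qed
      ultimately have "(\<lambda>D. P \<otimes>\<^bsub>SL2\<^esub> D \<otimes>\<^bsub>SL2\<^esub> inv\<^bsub>SL2\<^esub> P) ` {D \<in> carrier SL2. D $ 1 $ 2 = 0 \<and> D $ 2 $ 1 = 0} =
        {h \<in> carrier SL2. h ** ?M = ?M ** h}"
        by (intro SL2_centralizer_conjugate)
      then show "maximal_torus {g \<in> carrier SL2. g ** ru = ru ** g}"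
        unfolding maximal_torus_def Let_def
        by (intro bexI[OF _ P]) (simp only: centralizer_Frobenius_stable C_eq simp_thms)
    next
      show "ru \<in> {g \<in> carrier SL2. g ** ru = ru ** g}"
        using lam by (simp add: ru_eq char2_simps[OF char2_of_card[OF card]])
    qed
  next
    fix T :: "('a ^ 2 ^ 2) set"
    assume T: "maximal_torus T \<and> ru \<in> T"
    define Diag where "Diag = {D \<in> carrier (SL2 :: ('a alg_closure ^ 2 ^ 2) monoid). D $ 1 $ 2 = 0 \<and> D $ 2 $ 1 = 0}"
    obtain P where P: "P \<in> carrier SL2"
      and T_eq: "T = {g \<in> carrier SL2. map_matrix to_ac g \<in> (\<lambda>D. P \<otimes>\<^bsub>SL2\<^esub> D \<otimes>\<^bsub>SL2\<^esub> inv\<^bsub>SL2\<^esub> P) ` Diag}"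
      using T unfolding maximal_torus_def Let_def Diag_def by blast
    then obtain Z where Z: "Z \<in> Diag" and M: "?M = P \<otimes>\<^bsub>SL2\<^esub> Z \<otimes>\<^bsub>SL2\<^esub> inv\<^bsub>SL2\<^esub> P"
      using T by blast
    then obtain al be where Z_eq: "Z = mat2 al 0 0 be" and det: "al * be = 1"
      by (cases Z rule: mat2_cases) (auto simp: Diag_def)
    \<comment> \<open>Traces are invariant under conjugation; equal eigenvalues would give trace 0
      in characteristic 2.\<close>
    have "al + be = ?l" using trace_conj[OF P M[unfolded Z_eq]] by (simp add: M_eq)
    then have "al \<noteq> be" using l by (auto simp: ch)
    then show "T = {g \<in> carrier SL2. g ** ru = ru ** g}"
      using SL2_centralizer_conjugate[OF P _ det M[unfolded Z_eq]] C_eq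
      unfolding T_eq Diag_def by simp
  qed
qed

subsection \<open>Reduction to cases (1) and (2)\<close>

text \<open>The square of x^(q/2) is x^q = x. As a power, the square root stays in any subfield
  containing \<open>x\<close>.\<close>

lemma char2_sqroot:
  "sqroot x = (x :: 'a) ^ (2 ^ (e - 1))" "(sqroot x)\<^sup>2 = (x :: 'a)"
proof -
  have "(2 :: nat) ^ e = 2 ^ (e - 1) * 2" using e by (cases e) auto
  then have "x = (x ^ (2 ^ (e - 1)))\<^sup>2"
    using power_CARD_eq_same[of x] by (simp add: card power_mult)
  then show "sqroot x = x ^ (2 ^ (e - 1))" "(sqroot x)\<^sup>2 = x"
    using sqroot_power2[OF char2_of_card[OF card]] by metis+
qed

lemma r_elt_square: "r_elt lam ** r_elt lam = mat 1"
  using lam by (simp add: r_elt_def mat_1_eq_mat2)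

lemma r_in_SL2: "r_elt lam \<in> carrier SL2" and u_in_SL2: "(u_elt :: 'a ^ 2 ^ 2) \<in> carrier SL2"
  using lam by (simp_all add: r_elt_def u_elt_def char2)

lemma words3I:
  assumes "x \<in> {mat 1, u_elt, r_elt lam}" "y \<in> {mat 1, u_elt, r_elt lam}" "z \<in> {mat 1, u_elt, r_elt lam}"
  shows "x ** y ** z \<in> words3 lam"
  using assms unfolding words3_def SL2_one mat_1_eq_mat2[symmetric]
  by (force simp: numeral_3_eq_3 set_mult_def SL2_one mat_1_eq_mat2[symmetric])

lemma words3_mem:
  "mat 1 \<in> words3 lam" "u_elt \<in> words3 lam" "r_elt lam \<in> words3 lam"
  "r_elt lam ** u_elt \<in> words3 lam" "u_elt ** r_elt lam \<in> words3 lam"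
  "r_elt lam ** u_elt ** r_elt lam \<in> words3 lam"
  using words3I[of "mat 1" "mat 1" "mat 1"] words3I[of u_elt "mat 1" "mat 1"]
    words3I[of "r_elt lam" "mat 1" "mat 1"] words3I[of "r_elt lam" u_elt "mat 1"]
    words3I[of u_elt "r_elt lam" "mat 1"] words3I[of "r_elt lam" u_elt "r_elt lam"]
  by simp_all

text \<open>A zero entry is moved to the upper right by r, for case (2). Multiplying by r on one
  side swaps the two nonvanishing quantities up to powers of \<open>lam\<close>, and on both sides
  it preserves them, so neither is lost.\<close>

lemma formulas_apply_cases:
  assumes h: "h \<in> carrier SL2"
    and tr: "h $ 1 $ 1 + h $ 2 $ 2 \<noteq> 0" and tr_r: "h $ 1 $ 2 + lam\<^sup>2 * h $ 2 $ 1 \<noteq> 0"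
  shows "\<exists>i \<in> {mat 1, r_elt lam}. \<exists>j \<in> {mat 1, r_elt lam}. formulas_apply lam (i ** h ** j)"
proof -
  obtain a b c d where h_eq: "h = mat2 a b c d" and det: "a * d - b * c = 1"
    using h by (rule SL2_cases)
  have r: "r_elt lam = mat2 0 lam (1 / lam) 0"
    by (simp add: r_elt_def field_simps)
  have nz: "a + d \<noteq> 0" "b + lam\<^sup>2 * c \<noteq> 0" using tr tr_r by (simp_all add: h_eq)
  note ABCD = ABCD_values_mat2
  have apply_case2: "formulas_apply lam (mat2 a 0 c d)"
    if "a * d - 0 * c = 1" "a + d \<noteq> 0" "c \<noteq> 0" for a c d
    using that lam unfolding formulas_apply_def case2_def ABCD[OF that(1)] by auto
  consider "b = 0" | "a = 0" | "d = 0" | "c = 0" | "a \<noteq> 0" "b \<noteq> 0" "c \<noteq> 0" "d \<noteq> 0" by blast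
  then show ?thesis
  proof cases
    case 1
    then have "formulas_apply lam (mat 1 ** h ** mat 1)"
      using apply_case2[of a d c] det nz by (simp add: h_eq)
    then show ?thesis by blast
  next
    case 2
    then have "formulas_apply lam (mat 1 ** h ** r_elt lam)"
      using apply_case2[of "b / lam" "lam * c" "d / lam"] det nz lam
      by (auto simp: h_eq r char2 field_simps power2_eq_square)
    then show ?thesis by blast
  next
    case 3
    then have "formulas_apply lam (r_elt lam ** h ** mat 1)"
      using apply_case2[of "lam * c" "b / lam" "a / lam"] det nz lam
      by (auto simp: h_eq r char2 field_simps power2_eq_square)
    then show ?thesis by blast
  next
    case 4
    then have "formulas_apply lam (r_elt lam ** h ** r_elt lam)"
      using apply_case2[of d a "b / lam\<^sup>2"] det nz lam
      by (auto simp: h_eq r char2 field_simps power2_eq_square)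
    then show ?thesis by blast
  next
    case 5
    then have "formulas_apply lam (mat 1 ** h ** mat 1)"
      using nz lam by (simp add: h_eq formulas_apply_def case1_def ABCD[OF det])
    then show ?thesis by blast
  qed
qed

text \<open>Write t = a + d and v = b + lam^2 c. The conditions v = 0 and t = b make g commute with
  ru, and t = 0 and v = lam^2 a make it invert ru. Excluding both keeps the new values of t and v
  nonzero for a suitable candidate.\<close>

lemma reduction_candidates:
  assumes g: "g \<in> carrier SL2 - commutes_or_inverts SL2 ru"
  shows "\<exists>g1 \<in> {mat 1, u_elt}. \<exists>g2 \<in> {mat 1, u_elt, r_elt lam ** u_elt}.
    (let h = g1 ** g ** g2 in h $ 1 $ 1 + h $ 2 $ 2 \<noteq> 0 \<and> h $ 1 $ 2 + lam\<^sup>2 * h $ 2 $ 1 \<noteq> 0)"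
proof -
  obtain a b c d where g_eq: "g = mat2 a b c d" and det: "a * d - b * c = 1"
    using g by (blast elim: SL2_cases)
  have u: "u_elt = (mat2 1 0 1 1 :: 'a ^ 2 ^ 2)" by (simp add: u_elt_def)
  have not_comm: "\<not> (b + lam\<^sup>2 * c = 0 \<and> a + d = b)"
  proof
    assume *: "b + lam\<^sup>2 * c = 0 \<and> a + d = b"
    then have b: "b = lam\<^sup>2 * c" by (simp add: char2)
    have "d = a + (a + d)" by (simp add: char2)
    also have "a + d = lam\<^sup>2 * c" using * b by simp
    finally have d: "d = a + lam\<^sup>2 * c" .
    from b d have "g ** mat2 lam lam (1 / lam) 0 = mat2 lam lam (1 / lam) 0 ** g"
      using lam by (simp add: g_eq char2 field_simps power2_eq_square)
    then show False using g by (simp add: commutes_or_inverts_def ru_eq)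
  qed
  have not_inv: "\<not> (a + d = 0 \<and> b + lam\<^sup>2 * c = lam\<^sup>2 * a)"
  proof
    assume *: "a + d = 0 \<and> b + lam\<^sup>2 * c = lam\<^sup>2 * a"
    then have d: "d = a" by (simp add: char2)
    have "b + lam\<^sup>2 * c + lam\<^sup>2 * c = lam\<^sup>2 * a + lam\<^sup>2 * c" using * by simp
    then have "b = lam\<^sup>2 * a + lam\<^sup>2 * c" by (simp add: char2 add.assoc)
    then have "g ** mat2 lam lam (1 / lam) 0 = mat2 0 lam (1 / lam) lam ** g"
      using lam d by (simp add: g_eq char2 field_simps power2_eq_square)
    then show False using g by (simp add: commutes_or_inverts_def ru_eq inv_ru_eq)
  qed
  consider (1) "a + d \<noteq> 0" "b + lam\<^sup>2 * c \<noteq> 0" | (2) "a + d \<noteq> 0" "b + lam\<^sup>2 * c = 0"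
    | (3) "a + d = 0" "b \<noteq> 0" | (4) "a + d = 0" "b = 0" by blast
  then show ?thesis
  proof cases
    case 1
    then show ?thesis by (intro bexI[of _ "mat 1"]) (auto simp: Let_def g_eq)
  next
    case 2
    \<comment> \<open>Passing to u g u keeps the trace t and changes v to v + lam^2 (t + b).\<close>
    have "b + lam\<^sup>2 * (a + b + c + d) = (b + lam\<^sup>2 * c) + lam\<^sup>2 * (a + d + b)"
      by (simp add: algebra_simps)
    also have "\<dots> \<noteq> 0" using 2 not_comm lam by (simp add: char2)
    finally have "b + lam\<^sup>2 * (a + b + c + d) \<noteq> 0" .
    then have "let h = u_elt ** g ** u_elt in h $ 1 $ 1 + h $ 2 $ 2 \<noteq> 0 \<and> h $ 1 $ 2 + lam\<^sup>2 * h $ 2 $ 1 \<noteq> 0"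
      using 2 by (simp add: u g_eq char2 algebra_simps)
    then show ?thesis by blast
  next
    case 3
    \<comment> \<open>Here u g has trace t + b = b, and v becomes v + lam^2 a.\<close>
    have "(b + lam\<^sup>2 * c) + lam\<^sup>2 * a \<noteq> 0" using 3 not_inv by (simp only: char2) blast
    then have "let h = u_elt ** g ** mat 1 in h $ 1 $ 1 + h $ 2 $ 2 \<noteq> 0 \<and> h $ 1 $ 2 + lam\<^sup>2 * h $ 2 $ 1 \<noteq> 0"
      using 3 by (simp add: u g_eq char2 algebra_simps)
    then show ?thesis by blast
  next
    case 4
    have d: "d = a" using 4 by (simp add: char2)
    have "c \<noteq> 0" "c \<noteq> a" using 4 not_comm not_inv by auto
    \<comment> \<open>For u g ru the trace is lam c and the second quantity is lam^3 (a +
      c).\<close>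
    then have "let h = u_elt ** g ** mat2 lam lam (1 / lam) 0 in h $ 1 $ 1 + h $ 2 $ 2 \<noteq> 0 \<and> h $ 1 $ 2 + lam\<^sup>2 * h $ 2 $ 1 \<noteq> 0"
      using 4(2) lam by (simp add: u g_eq d char2 field_simps power2_eq_square)
    then show ?thesis unfolding ru_eq by blast
  qed
qed

text \<open>The memberships of \<open>r_elt lam ** G1\<close> and \<open>G2 ** r_elt lam\<close>
  place h r, r h and r h r in the required double product, for h = \<open>G1 ** g ** G2\<close>. An
  outer r already present cancels by r^2 = 1, so no word exceeds length 3.\<close>

lemma reduction_exists:
  assumes g: "g \<in> carrier SL2 - commutes_or_inverts SL2 ru"
  obtains G1 G2 where "G1 \<in> generate SL2 {u_elt, r_elt lam}" "G2 \<in> generate SL2 {u_elt, r_elt lam}"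
    "G1 \<in> words3 lam" "r_elt lam ** G1 \<in> words3 lam" "G2 \<in> words3 lam" "G2 ** r_elt lam \<in> words3 lam"
    "formulas_apply lam (G1 ** g ** G2)"
proof -
  let ?r = "r_elt lam" and ?u = "u_elt :: 'a ^ 2 ^ 2"
  note r_in = r_in_SL2 and u_in = u_in_SL2
  have rr: "?r ** ?r = mat 1" by (rule r_elt_square)
  have rr': "?r ** (?r ** x) = x" for x by (simp add: matrix_mul_assoc rr)
  have gen: "mat 1 \<in> generate SL2 {?u, ?r}" "?u \<in> generate SL2 {?u, ?r}" "?r \<in> generate SL2 {?u, ?r}"
    "\<And>x y. x \<in> generate SL2 {?u, ?r} \<Longrightarrow> y \<in> generate SL2 {?u, ?r} \<Longrightarrow> x ** y \<in> generate SL2 {?u, ?r}"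
    using generate.one[of SL2 "{?u, ?r}"] generate.incl[of _ "{?u, ?r}" SL2]
      generate.eng[of _ SL2 "{?u, ?r}"] by (auto simp: SL2_one mat_1_eq_mat2)
  obtain g1 g2 where g1: "g1 \<in> {mat 1, ?u}" and g2: "g2 \<in> {mat 1, ?u, ?r ** ?u}"
    and h: "(g1 ** g ** g2) $ 1 $ 1 + (g1 ** g ** g2) $ 2 $ 2 \<noteq> 0"
      "(g1 ** g ** g2) $ 1 $ 2 + lam\<^sup>2 * (g1 ** g ** g2) $ 2 $ 1 \<noteq> 0"
    using reduction_candidates[OF g] unfolding Let_def by blast
  have "g1 \<in> carrier SL2" "g2 \<in> carrier SL2"
    using g1 g2 u_in r_in SL2.m_closed[OF r_in u_in] SL2.one_closed by (auto simp: SL2_one mat_1_eq_mat2)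
  then have "g1 ** g ** g2 \<in> carrier SL2"
    using g by (simp add: SL2_carrier det_mul)
  from formulas_apply_cases[OF this h]
  obtain i j where i: "i \<in> {mat 1, ?r}" and j: "j \<in> {mat 1, ?r}"
    and "formulas_apply lam (i ** (g1 ** g ** g2) ** j)" by blast
  then have "formulas_apply lam ((i ** g1) ** g ** (g2 ** j))"
    by (simp add: matrix_mul_assoc)
  moreover have "i ** g1 \<in> generate SL2 {?u, ?r}" "g2 ** j \<in> generate SL2 {?u, ?r}"
    using g1 g2 i j gen by auto
  moreover have "i ** g1 \<in> words3 lam" "?r ** (i ** g1) \<in> words3 lam"
    using g1 i words3_mem by (auto simp: rr rr')
  moreover have "g2 ** j \<in> words3 lam" "(g2 ** j) ** ?r \<in> words3 lam"
    using g2 j words3_mem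
    by (auto simp: rr matrix_mul_assoc[of ?u, symmetric] matrix_mul_assoc[of "?r ** ?u" ?r ?r, symmetric])
  ultimately show thesis using that by blast
qed

lemma formulas_apply_iff:
  assumes "g \<in> carrier SL2"
  shows "formulas_apply lam g \<longleftrightarrow> (\<exists>A B C D. case1 lam g A B C D \<and> formulas1 lam g A B C D) \<or>
    (\<exists>B C D. case2 lam g B C D \<and> formulas2 lam g B C D)"
  using case1_formulas1[OF assms] case2_formulas2[OF assms]
  unfolding formulas_apply_def by blast

lemma reduction3_holds:
  assumes g: "g \<in> carrier SL2 - commutes_or_inverts SL2 ru"
  shows "reduction3 lam g"
proof -
  let ?r = "r_elt lam"
  note r_in = r_in_SL2 and u_in = u_in_SL2
  from g obtain G1 G2 where G: "G1 \<in> generate SL2 {u_elt, ?r}" "G2 \<in> generate SL2 {u_elt, ?r}"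
    and W: "G1 \<in> words3 lam" "?r ** G1 \<in> words3 lam" "G2 \<in> words3 lam" "G2 ** ?r \<in> words3 lam"
    and h: "formulas_apply lam (G1 ** g ** G2)"
    by (rule reduction_exists)
  have G_in: "G1 \<in> carrier SL2" "G2 \<in> carrier SL2"
    using G SL2.generate_in_carrier[of "{u_elt, ?r}"] r_in u_in by auto
  have h_in: "G1 ** g ** G2 \<in> carrier SL2"
    using G_in g by (simp add: SL2_carrier det_mul)
  let ?S = "words3 lam <#>\<^bsub>SL2\<^esub> {g} <#>\<^bsub>SL2\<^esub> words3 lam"
  have S: "x ** g ** y \<in> ?S" if "x \<in> words3 lam" "y \<in> words3 lam" for x y
    using that by (auto simp: set_mult_def)
  have "{G1 ** g ** G2, G1 ** g ** G2 ** ?r, ?r ** (G1 ** g ** G2), ?r ** (G1 ** g ** G2) ** ?r} \<subseteq> ?S"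
    using S[OF W(1,3)] S[OF W(1,4)] S[OF W(2,3)] S[OF W(2,4)] by (simp add: matrix_mul_assoc)
  moreover have "g = inv\<^bsub>SL2\<^esub> G1 \<otimes>\<^bsub>SL2\<^esub> (G1 \<otimes>\<^bsub>SL2\<^esub> g \<otimes>\<^bsub>SL2\<^esub> G2) \<otimes>\<^bsub>SL2\<^esub> inv\<^bsub>SL2\<^esub> G2"
    using G_in g by (simp del: SL2_mult flip: SL2.m_assoc) (simp add: SL2.m_assoc del: SL2_mult)
  ultimately show ?thesis
    using G h formulas_apply_iff[OF h_in] unfolding reduction3_def Let_def SL2_mult by blast
qed

section \<open>Recovering lambda, the entries and the field from the values\<close>

text \<open>\<open>K\<close> is closed under square roots, so the formulas put \<open>lam\<close>
  and the entries of \<open>G1 ** g ** G2\<close> into \<open>K\<close>. Then u and r lie in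
  SL(2,K), and removing \<open>G1\<close> and \<open>G2\<close> stays there. Both halves of the
  theorem rest on this.\<close>

lemma entries_in_subfield:
  assumes g: "g \<in> carrier SL2 - commutes_or_inverts SL2 ru"
    and K: "subfield K ring_of_type_algebra" and vals: "BB21_values lam {g} \<subseteq> K"
  shows "lam \<in> K" and "g $ i $ j \<in> K"
proof -
  let ?r = "r_elt lam"
  note K_closed = subfield_type_closed[OF K]
  note r_in = r_in_SL2 and u_in = u_in_SL2
  have sqroot_K: "sqroot x \<in> K" if "x \<in> K" for x
    using K_closed(9)[OF that] char2_sqroot(1) by simp
  have power2_K: "x \<in> K" if "x\<^sup>2 \<in> K" for x
    using sqroot_K[OF that] sqroot_power2[OF char2_of_card[OF card]] by simp
  from g obtain G1 G2 where G: "G1 \<in> generate SL2 {u_elt, ?r}" "G2 \<in> generate SL2 {u_elt, ?r}"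
    and W: "G1 \<in> words3 lam" "?r ** G1 \<in> words3 lam" "G2 \<in> words3 lam" "G2 ** ?r \<in> words3 lam"
    and h: "formulas_apply lam (G1 ** g ** G2)"
    by (rule reduction_exists)
  have G_in: "G1 \<in> carrier SL2" "G2 \<in> carrier SL2"
    using G SL2.generate_in_carrier[of "{u_elt, ?r}"] r_in u_in by auto
  let ?h = "G1 ** g ** G2"
  have h_in: "?h \<in> carrier SL2"
    using G_in g by (simp add: SL2_carrier det_mul)
  have val: "y \<in> K" if "BB21 (x ** g ** z) = Some y" "x \<in> words3 lam" "z \<in> words3 lam" for x y z
    using that vals by (auto simp: BB21_values_def)
  have ABCD: "x - 1 \<in> K"
    if "BB21 ?h = Some x \<or> BB21 (?h ** ?r) = Some x \<or> BB21 (?r ** ?h) = Some x \<or> BB21 (?r ** ?h ** ?r) = Some x" for x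
  proof -
    have "x \<in> K"
      using that val[of G1 G2 x] val[of G1 "G2 ** ?r" x] val[of "?r ** G1" G2 x] val[of "?r ** G1" "G2 ** ?r" x] W
      by (auto simp: matrix_mul_assoc)
    then show ?thesis using K_closed by blast
  qed
  have lam_h: "lam \<in> K \<and> (\<forall>i j. ?h $ i $ j \<in> K)"
    using h unfolding formulas_apply_iff[OF h_in]
  proof (elim disjE exE conjE)
    fix A B C D assume c: "case1 lam ?h A B C D" and f: "formulas1 lam ?h A B C D"
    have mem: "A \<in> K" "B \<in> K" "C \<in> K" "D \<in> K"
      using c ABCD by (auto simp: case1_def ABCD_values_def Let_def)
    have "A * B * C * D * lam\<^sup>2 = (A + D) * (B + C)"
      using f by (simp add: formulas1_def)
    moreover have "A * B * C * D \<noteq> 0" using c by (simp add: case1_def)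
    \<comment> \<open>The determining equation is solved for \<open>lam^2\<close> inside
      \<open>K\<close>; then \<open>lam\<close> itself follows by a square root.\<close>
    ultimately have "lam\<^sup>2 = (A + D) * (B + C) / (A * B * C * D)"
      by (metis nonzero_mult_div_cancel_left)
    then have "lam\<^sup>2 \<in> K" by (simp only:) (intro K_closed mem)
    then have lam_K: "lam \<in> K" by (rule power2_K)
    let ?Delta = "sqroot (inverse (lam\<^sup>2) * A * D * (B + C) * (A + B + C + D))"
    have h_eq: "?h = mat2 (A * C * D / ?Delta) (D * (B + C) / ?Delta)
        (inverse (lam\<^sup>2) * A * (B + C) / ?Delta) (A * B * D / ?Delta)"
      using f by (simp add: formulas1_def Let_def)
    show ?thesis
      unfolding h_eq forall_2 mat2_nth by (intro conjI K_closed sqroot_K mem lam_K)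
  next
    fix B C D assume c: "case2 lam ?h B C D" and f: "formulas2 lam ?h B C D"
    have mem: "B \<in> K" "C \<in> K" "D \<in> K"
      using c ABCD by (auto simp: case2_def ABCD_values_def Let_def)
    have "B * C * D * lam\<^sup>2 = B + C"
      using f by (simp add: formulas2_def)
    moreover have "B * C * D \<noteq> 0" using c by (simp add: case2_def)
    ultimately have "lam\<^sup>2 = (B + C) / (B * C * D)"
      by (metis nonzero_mult_div_cancel_left)
    then have "lam\<^sup>2 \<in> K" by (simp only:) (intro K_closed mem)
    then have lam_K: "lam \<in> K" by (rule power2_K)
    have h_eq: "?h = mat2 (C / sqroot (B * C)) 0 (B * C / sqroot (B * C)) (B / sqroot (B * C))"
      using f by (simp add: formulas2_def Let_def)
    show ?thesis
      unfolding h_eq forall_2 mat2_nth by (intro conjI K_closed sqroot_K mem lam_K)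
  qed
  then show lam_K: "lam \<in> K" ..
  define H where "H = {g \<in> carrier (SL2 :: ('a ^ 2 ^ 2) monoid). \<forall>i j. g $ i $ j \<in> K}"
  have H: "subgroup H SL2" unfolding H_def by (rule subgroup_SL2_subfield[OF K])
  have "{u_elt, ?r} \<subseteq> H"
    using r_in u_in lam_K K_closed by (auto simp: H_def forall_2 u_elt_def r_elt_def)
  then have "generate SL2 {u_elt, ?r} \<subseteq> H"
    using H SL2.generate_subgroup_incl by blast
  then have G_H: "G1 \<in> H" "G2 \<in> H" using G by auto
  have "G1 \<otimes>\<^bsub>SL2\<^esub> g \<otimes>\<^bsub>SL2\<^esub> G2 \<in> H" using lam_h h_in by (simp add: H_def)
  then have "inv\<^bsub>SL2\<^esub> G1 \<otimes>\<^bsub>SL2\<^esub> (G1 \<otimes>\<^bsub>SL2\<^esub> g \<otimes>\<^bsub>SL2\<^esub> G2) \<otimes>\<^bsub>SL2\<^esub> inv\<^bsub>SL2\<^esub> G2 \<in> H"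
    using subgroup.m_closed[OF H] subgroup.m_inv_closed[OF H] G_H by blast
  also have "inv\<^bsub>SL2\<^esub> G1 \<otimes>\<^bsub>SL2\<^esub> (G1 \<otimes>\<^bsub>SL2\<^esub> g \<otimes>\<^bsub>SL2\<^esub> G2) \<otimes>\<^bsub>SL2\<^esub> inv\<^bsub>SL2\<^esub> G2 = g"
    using G_in g by (simp del: SL2_mult flip: SL2.m_assoc) (simp add: SL2.m_assoc del: SL2_mult)
  finally show "g $ i $ j \<in> K" by (simp add: H_def)
qed

text \<open>Here e > 1 enters, supplying some c other than 0 and 1. A lower unitriangular matrix
  with entry c commutes with ru only for c = 0 and inverts it only for c = 1.\<close>

lemma commutes_or_inverts_ne_carrier:
  assumes "e > 1"
  shows "commutes_or_inverts SL2 ru \<noteq> carrier SL2"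
proof
  assume eq: "commutes_or_inverts SL2 ru = carrier SL2"
  have "card {0, 1 :: 'a} < CARD('a)"
    using \<open>e > 1\<close> power_strict_increasing[of 1 e "2 :: nat"] by (simp add: card)
  then have "{0, 1 :: 'a} \<noteq> UNIV" by (metis less_irrefl)
  then obtain c :: 'a where c: "c \<noteq> 0" "c \<noteq> 1" by blast
  have "mat2 1 0 c 1 \<in> commutes_or_inverts SL2 ru"
    by (simp add: eq)
  then show False
    using c lam by (auto simp: commutes_or_inverts_def ru_eq inv_ru_eq char2)
qed

text \<open>The formulas do not reach elements of \<open>S\<close> inside \<open>?N\<close>; for
  these, S^2 supplies products outside \<open>?N\<close>.\<close>

lemma generates_as_field_BB21_values:
  assumes "e > 1" and S: "S \<subseteq> carrier SL2" and gen: "generate SL2 S = carrier SL2"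
  shows "generates_as_field (BB21_values lam (S \<union> set_power SL2 S 2))"
  unfolding generates_as_field_def
proof (intro allI impI, elim conjE)
  fix K :: "'a set"
  assume K: "subfield K ring_of_type_algebra" and vals: "BB21_values lam (S \<union> set_power SL2 S 2) \<subseteq> K"
  let ?N = "commutes_or_inverts SL2 ru"
  define H where "H = {g \<in> carrier (SL2 :: ('a ^ 2 ^ 2) monoid). \<forall>i j. g $ i $ j \<in> K}"
  have H: "subgroup H SL2" unfolding H_def by (rule subgroup_SL2_subfield[OF K])
  have N: "subgroup ?N SL2"
    using SL2.m_closed[OF r_in_SL2 u_in_SL2]
    by (intro SL2.subgroup_commutes_or_inverts) simp
  have in_H: "g \<in> H" if "g \<in> S \<union> set_power SL2 S 2" "g \<in> carrier SL2 - ?N" for g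
    using entries_in_subfield(2)[OF that(2) K] that vals
    unfolding H_def BB21_values_def by blast
  \<comment> \<open>Otherwise \<open>S\<close> would generate a subgroup of the proper subgroup
    \<open>?N\<close>.\<close>
  have "\<not> S \<subseteq> ?N"
    using SL2.generate_subgroup_incl[OF _ N] gen commutes_or_inverts_ne_carrier[OF \<open>e > 1\<close>]
      subgroup.subset[OF N] by blast
  then obtain s where s: "s \<in> S" "s \<notin> ?N" by blast
  then have s_H: "s \<in> H" using S in_H by blast
  have "g \<in> H" if g: "g \<in> S" for g
  proof (cases "g \<in> ?N")
    case True
    have gs: "g \<in> carrier SL2" "s \<in> carrier SL2" using g s S by auto
    \<comment> \<open>With g inside and s outside the subgroup, g s is outside, hence in
      \<open>H\<close>; then g = (g s) s^-1 is in \<open>H\<close>.\<close>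
    have "g \<otimes>\<^bsub>SL2\<^esub> s \<notin> ?N"
    proof
      assume "g \<otimes>\<^bsub>SL2\<^esub> s \<in> ?N"
      then have "inv\<^bsub>SL2\<^esub> g \<otimes>\<^bsub>SL2\<^esub> (g \<otimes>\<^bsub>SL2\<^esub> s) \<in> ?N"
        by (rule subgroup.m_closed[OF N subgroup.m_inv_closed[OF N True]])
      then show False using s gs by (simp del: SL2_mult flip: SL2.m_assoc)
    qed
    moreover have "g \<otimes>\<^bsub>SL2\<^esub> s \<in> set_power SL2 S 2"
      using g s S by (auto simp: numeral_2_eq_2 set_mult_def SL2_one mat_1_eq_mat2[symmetric])
    ultimately have "g \<otimes>\<^bsub>SL2\<^esub> s \<in> H"
      using in_H gs SL2.m_closed by blast
    then have "g \<otimes>\<^bsub>SL2\<^esub> s \<otimes>\<^bsub>SL2\<^esub> inv\<^bsub>SL2\<^esub> s \<in> H"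
      by (rule subgroup.m_closed[OF H _ subgroup.m_inv_closed[OF H s_H]])
    then show ?thesis using gs by (simp add: SL2.m_assoc del: SL2_mult)
  qed (use g S in_H in blast)
  then have "carrier SL2 \<subseteq> H"
    using SL2.generate_subgroup_incl[OF _ H, of S] gen by blast
  \<comment> \<open>The upper unitriangular matrices carry every field element as an entry.\<close>
  moreover have "mat2 1 x 0 1 \<in> carrier SL2" for x :: 'a by simp
  ultimately have "mat2 1 x 0 1 \<in> H" for x by blast
  then show "K = UNIV" by (auto simp: H_def forall_2)
qed

text \<open>The field generated by the square roots contains their squares, which are the values
  themselves, so \<open>entries_in_subfield\<close> applies to it.\<close>

lemma subset_rational_in_sqroot:
  assumes g: "g \<in> carrier SL2 - commutes_or_inverts SL2 ru"
  shows "{lam, g $ 1 $ 1, g $ 1 $ 2, g $ 2 $ 1, g $ 2 $ 2} \<subseteq> rational_in (sqroot ` BB21_values lam {g})"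
    (is "_ \<subseteq> ?K")
proof -
  interpret R: field "ring_of_type_algebra :: 'a ring" by (rule field_from_type_algebra)
  have K: "subfield ?K ring_of_type_algebra"
    unfolding rational_in_def
    by (rule R.generate_field_is_subfield) (simp add: ring_of_type_algebra_def)
  have "BB21_values lam {g} \<subseteq> ?K"
  proof
    fix y assume "y \<in> BB21_values lam {g}"
    then have "sqroot y \<in> ?K" unfolding rational_in_def by (intro generate_field.incl imageI)
    then have "(sqroot y)\<^sup>2 \<in> ?K" by (rule subfield_type_closed(9)[OF K])
    then show "y \<in> ?K" by (simp add: char2_sqroot(2))
  qed
  then show ?thesis using entries_in_subfield[OF g K] by blast
qed

end

theorem proposition9:
  fixes lam :: "'a::{field,finite}" and e :: nat
  assumes "CARD('a) = 2 ^ e" and "e > 1" and "lam \<noteq> 0"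
  shows "(\<forall>g \<in> carrier SL2 - normalizer SL2 (torus_containing (r_elt lam \<otimes>\<^bsub>SL2\<^esub> u_elt)).
      (\<forall>A B C D. case1 lam g A B C D \<longrightarrow> formulas1 lam g A B C D) \<and>
      (\<forall>B C D. case2 lam g B C D \<longrightarrow> formulas2 lam g B C D) \<and>
      ((\<nexists>A B C D. case1 lam g A B C D) \<and> (\<nexists>B C D. case2 lam g B C D) \<longrightarrow> reduction3 lam g) \<and>
      {lam, g $ 1 $ 1, g $ 1 $ 2, g $ 2 $ 1, g $ 2 $ 2}
        \<subseteq> rational_in (sqroot ` BB21_values lam {g})) \<and>
    (\<forall>S. S \<subseteq> carrier SL2 \<and> generate SL2 S = carrier SL2 \<longrightarrow>
      generates_as_field (BB21_values lam (S \<union> set_power SL2 S 2)))"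
proof -
  have e: "e > 0" using assms(2) by simp
  note hyps = assms(1) e assms(3)
  have ru_in: "r_elt lam ** u_elt \<in> carrier SL2"
    using SL2.m_closed[OF r_in_SL2[OF hyps] u_in_SL2[OF hyps]] by simp
  \<comment> \<open>This inclusion turns g outside N into the hypothesis of the preceding
    lemmas.\<close>
  have normalizer: "commutes_or_inverts SL2 (r_elt lam ** u_elt)
    \<subseteq> normalizer SL2 (torus_containing (r_elt lam \<otimes>\<^bsub>SL2\<^esub> u_elt))"
    using SL2.commutes_or_inverts_le_normalizer[OF ru_in] torus_containing_ru[OF hyps] by simp
  show ?thesis
  proof (intro conjI ballI)
    fix g assume g: "g \<in> carrier SL2 - normalizer SL2 (torus_containing (r_elt lam \<otimes>\<^bsub>SL2\<^esub> u_elt))"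
    then have g_in: "g \<in> carrier SL2" by blast
    have g': "g \<in> carrier SL2 - commutes_or_inverts SL2 (r_elt lam ** u_elt)"
      using g normalizer by blast
    show "\<forall>A B C D. case1 lam g A B C D \<longrightarrow> formulas1 lam g A B C D"
      using case1_formulas1[OF hyps g_in] by blast
    show "\<forall>B C D. case2 lam g B C D \<longrightarrow> formulas2 lam g B C D"
      using case2_formulas2[OF hyps g_in] by blast
    show "(\<nexists>A B C D. case1 lam g A B C D) \<and> (\<nexists>B C D. case2 lam g B C D) \<longrightarrow> reduction3 lam g"
      using reduction3_holds[OF hyps g'] by (rule impI)
    show "{lam, g $ 1 $ 1, g $ 1 $ 2, g $ 2 $ 1, g $ 2 $ 2} \<subseteq> rational_in (sqroot ` BB21_values lam {g})"
      by (rule subset_rational_in_sqroot[OF hyps g'])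
  qed (use generates_as_field_BB21_values[OF hyps assms(2)] in blast)
qed

end
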